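(* Let $\varphi\in L^\infty$, let $\alpha,\theta$ be inner functions, and let $$A=\begin{bmatrix}\varphi\theta & -1\\ \varphi\theta\bar\alpha & 0\end{bmatrix},\qquad B=\begin{bmatrix}\varphi & 0\\ \bar\alpha\varphi & -1\end{bmatrix}.$$ The map $$\mathcal N\colon\ker D_\varphi^{\theta,\alpha}\to\ker(AP^++BP^-),\qquad \mathcal N(f_-+\theta\tilde f_+)=\begin{bmatrix}f_-+\tilde f_+\\ \varphi(1+\bar\alpha)(f_-+\theta\tilde f_+)\end{bmatrix},$$ where $f_-\in H^2_-$, $\tilde f_+\in H^2$, is an isomorphism, and $$\ker D_\varphi^{\theta,\alpha}=(P^-+\theta P^+)\,P_1\big(\ker(AP^++BP^-)\big),$$ where $P_1\left(\begin{bmatrix}x\\ y\end{bmatrix}\right)=x$.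
   Context: $L^2=L^2(\mathbb T)$, $L^\infty=L^\infty(\mathbb T)$, $\mathbb T$ the unit circle; $H^2$ is the Hardy space of the unit disk viewed as a subspace of $L^2$, and $H^2_-=\bar z\,\overline{H^2}=L^2\ominus H^2$. $P^+$ and $P^-=I-P^+$ are the orthogonal projections of $L^2$ onto $H^2$ and $H^2_-$; they act componentwise on $L^2\oplus L^2$. Matrices in $(L^\infty)^{2\times2}$ are identified with the corresponding multiplication operators on $L^2\oplus L^2$, so $AP^++BP^-$ is an operator on $L^2\oplus L^2$. For an inner function $\theta$, $K_\theta=H^2\ominus\theta H^2$, $(K_\theta)^\perp=L^2\ominus K_\theta=H^2_-\oplus\theta H^2$, and $Q_\theta$ is the orthogonal projection of $L^2$ onto $(K_\theta)^\perp$. For $\varphi\in L^\infty$ and inner $\alpha,\theta$, $D_\varphi^{\theta,\alpha}\colon (K_\theta)^\perp\to(K_\alpha)^\perp$ is defined by $D_\varphi^{\theta,\alpha}f=Q_\alpha(\varphi f)$. *)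

theory Defs
  imports "HOL-Complex_Analysis.Complex_Analysis"
begin

section \<open>The spaces of square-integrable and of essentially bounded functions on the circle\<close>

text \<open>Normalized arc length on the unit circle, as a measure whose underlying space is the circle.\<close>

definition circle :: "complex measure" where
  "circle = distr (uniform_measure lborel {0..2*pi}) (restrict_space borel (sphere 0 1)) cis"

lemma space_circle [simp]: "space circle = sphere 0 1"
  by (simp add: circle_def space_restrict_space)

lemma emeasure_circle: "emeasure circle (sphere 0 1) = 1"
proof -
  have "cis \<in> borel_measurable borel"
    by (intro borel_measurable_continuous_onI continuous_intros)
  then have m: "cis \<in> measurable (uniform_measure lborel {0..2*pi}) (restrict_space borel (sphere 0 1))"
    by (intro measurable_restrict_space2) auto
  have "sphere 0 1 \<in> sets (restrict_space borel (sphere (0::complex) 1))"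
    by (subst sets_restrict_space_iff) auto
  moreover have "cis -` sphere 0 1 = UNIV"
    by auto
  ultimately show ?thesis
    unfolding circle_def by (subst emeasure_distr[OF m]) auto
qed

lemma finite_measure_circle: "finite_measure circle"
  by (rule finite_measureI) (simp only: space_circle emeasure_circle, simp)

lemma integrable_const_circle [simp]: "integrable circle (\<lambda>z. c :: real)"
  using finite_measure_circle by (rule finite_measure.integrable_const)

lemma not_AE_circle_False: "\<not> (AE z in circle. False)"
proof
  assume "AE z in circle. False"
  then obtain N where "{z \<in> space circle. \<not> False} \<subseteq> N" "emeasure circle N = 0" "N \<in> sets circle"
    by (rule AE_E)
  then have N: "sphere 0 1 \<subseteq> N" "emeasure circle N = 0" "N \<in> sets circle"
    by auto
  then have "emeasure circle (sphere 0 1) \<le> 0"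
    using emeasure_mono[OF N(1,3)] by simp
  then show False by (simp add: emeasure_circle)
qed

lemma borel_measurable_cnj [measurable]: "cnj \<in> borel_measurable borel"
  by (intro borel_measurable_continuous_onI continuous_intros)

definition square_integrable :: "(complex \<Rightarrow> complex) \<Rightarrow> bool" where
  "square_integrable f \<longleftrightarrow> f \<in> borel_measurable circle \<and> integrable circle (\<lambda>z. (norm (f z))\<^sup>2)"

definition ess_bounded :: "(complex \<Rightarrow> complex) \<Rightarrow> bool" where
  "ess_bounded f \<longleftrightarrow> f \<in> borel_measurable circle \<and> (\<exists>C. AE z in circle. norm (f z) \<le> C)"

lemma square_integrable_mult:
  assumes "square_integrable f" "square_integrable g"
  shows "integrable circle (\<lambda>z. f z * cnj (g z))"
proof (rule Bochner_Integration.integrable_bound)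
  show "integrable circle (\<lambda>z. (norm (f z))\<^sup>2 + (norm (g z))\<^sup>2)"
    using assms by (auto simp: square_integrable_def)
  show "(\<lambda>z. f z * cnj (g z)) \<in> borel_measurable circle"
    using assms by (auto simp: square_integrable_def)
  have "a * b \<le> a\<^sup>2 + b\<^sup>2" if "a \<ge> 0" "b \<ge> 0" for a b :: real
    using sum_squares_bound[of a b] mult_nonneg_nonneg[OF that] by linarith
  then show "AE z in circle. norm (f z * cnj (g z)) \<le> norm ((norm (f z))\<^sup>2 + (norm (g z))\<^sup>2)"
    by (auto simp: norm_mult)
qed

lemma square_integrable_add:
  assumes "square_integrable f" "square_integrable g"
  shows "square_integrable (\<lambda>z. f z + g z)"
  unfolding square_integrable_def
proof
  show "(\<lambda>z. f z + g z) \<in> borel_measurable circle"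
    using assms by (auto simp: square_integrable_def)
  show "integrable circle (\<lambda>z. (norm (f z + g z))\<^sup>2)"
  proof (rule Bochner_Integration.integrable_bound)
    show "integrable circle (\<lambda>z. 2 * (norm (f z))\<^sup>2 + 2 * (norm (g z))\<^sup>2)"
      using assms by (auto simp: square_integrable_def)
    show "(\<lambda>z. (norm (f z + g z))\<^sup>2) \<in> borel_measurable circle"
      using assms by (auto simp: square_integrable_def)
    have "(norm (a + b))\<^sup>2 \<le> 2 * (norm a)\<^sup>2 + 2 * (norm b)\<^sup>2" for a b :: complex
    proof -
      have "(norm (a + b))\<^sup>2 \<le> (norm a + norm b)\<^sup>2"
        by (simp add: norm_triangle_ineq power_mono)
      also have "\<dots> \<le> 2 * (norm a)\<^sup>2 + 2 * (norm b)\<^sup>2"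
        using sum_squares_bound[of "norm a" "norm b"] by (simp add: power2_sum)
      finally show ?thesis .
    qed
    then show "AE z in circle. norm ((norm (f z + g z))\<^sup>2) \<le> norm (2 * (norm (f z))\<^sup>2 + 2 * (norm (g z))\<^sup>2)"
      by auto
  qed
qed

lemma square_integrable_mult_bounded:
  assumes "ess_bounded f" "square_integrable g"
  shows "square_integrable (\<lambda>z. f z * g z)"
proof -
  obtain C where C: "AE z in circle. norm (f z) \<le> C"
    using assms by (auto simp: ess_bounded_def)
  have "integrable circle (\<lambda>z. (norm (f z * g z))\<^sup>2)"
  proof (rule Bochner_Integration.integrable_bound)
    show "integrable circle (\<lambda>z. C\<^sup>2 * (norm (g z))\<^sup>2)"
      using assms by (auto simp: square_integrable_def)
    show "(\<lambda>z. (norm (f z * g z))\<^sup>2) \<in> borel_measurable circle"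
      using assms by (auto simp: square_integrable_def ess_bounded_def)
    show "AE z in circle. norm ((norm (f z * g z))\<^sup>2) \<le> norm (C\<^sup>2 * (norm (g z))\<^sup>2)"
      using C
      by eventually_elim (auto simp: norm_mult power_mult_distrib intro!: mult_right_mono power_mono)
  qed
  then show ?thesis
    using assms by (auto simp: square_integrable_def ess_bounded_def)
qed

lemma ess_bounded_const: "ess_bounded (\<lambda>z. c)"
  by (auto simp: ess_bounded_def)

lemma square_integrable_scale:
  "square_integrable f \<Longrightarrow> square_integrable (\<lambda>z. c * f z)"
  using square_integrable_mult_bounded[OF ess_bounded_const] .

lemma ess_bounded_add:
  assumes "ess_bounded f" "ess_bounded g"
  shows "ess_bounded (\<lambda>z. f z + g z)"
proof -
  obtain C D where C: "AE z in circle. norm (f z) \<le> C" and D: "AE z in circle. norm (g z) \<le> D"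
    using assms by (auto simp: ess_bounded_def)
  from C D have "AE z in circle. norm (f z + g z) \<le> C + D"
    by eventually_elim (rule norm_triangle_mono)
  then show ?thesis
    using assms by (auto simp: ess_bounded_def)
qed

lemma ess_bounded_mult:
  assumes "ess_bounded f" "ess_bounded g"
  shows "ess_bounded (\<lambda>z. f z * g z)"
proof -
  obtain C D where C: "AE z in circle. norm (f z) \<le> C" and D: "AE z in circle. norm (g z) \<le> D"
    using assms by (auto simp: ess_bounded_def)
  from C D have "AE z in circle. norm (f z * g z) \<le> C * D"
    by eventually_elim (auto simp: norm_mult intro: mult_mono order_trans[OF norm_ge_zero])
  then show ?thesis
    using assms by (auto simp: ess_bounded_def)
qed

quotient_type L2 = "complex \<Rightarrow> complex" / partial:
  "\<lambda>f g. square_integrable f \<and> square_integrable g \<and> (AE z in circle. f z = g z)"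
proof (rule part_equivpI)
  show "\<exists>x. square_integrable x \<and> square_integrable x \<and> (AE z in circle. x z = x z)"
    by (rule exI[of _ "\<lambda>_. 0"]) (simp add: square_integrable_def)
qed (auto intro!: sympI transpI)

quotient_type Linf = "complex \<Rightarrow> complex" / partial:
  "\<lambda>f g. ess_bounded f \<and> ess_bounded g \<and> (AE z in circle. f z = g z)"
proof (rule part_equivpI)
  show "\<exists>x. ess_bounded x \<and> ess_bounded x \<and> (AE z in circle. x z = x z)"
    by (rule exI[of _ "\<lambda>_. 0"]) (simp add: ess_bounded_const)
qed (auto intro!: sympI transpI)

lift_definition cinner :: "L2 \<Rightarrow> L2 \<Rightarrow> complex" is
  "\<lambda>f g. LINT z|circle. f z * cnj (g z)"
proof (intro integral_cong_AE)
  fix f1 f2 g1 g2 :: "complex \<Rightarrow> complex"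
  assume f: "square_integrable f1 \<and> square_integrable f2 \<and> (AE z in circle. f1 z = f2 z)"
     and g: "square_integrable g1 \<and> square_integrable g2 \<and> (AE z in circle. g1 z = g2 z)"
  show "(\<lambda>z. f1 z * cnj (g1 z)) \<in> borel_measurable circle"
       "(\<lambda>z. f2 z * cnj (g2 z)) \<in> borel_measurable circle"
    using f g by (auto simp: square_integrable_def)
  have "AE z in circle. f1 z = f2 z" "AE z in circle. g1 z = g2 z"
    using f g by auto
  then show "AE z in circle. f1 z * cnj (g1 z) = f2 z * cnj (g2 z)"
    by eventually_elim auto
qed

instantiation L2 :: real_inner
begin

lift_definition zero_L2 :: L2 is "\<lambda>z. 0"
  by (simp add: square_integrable_def)

lift_definition plus_L2 :: "L2 \<Rightarrow> L2 \<Rightarrow> L2" is "\<lambda>f g z. f z + g z"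
  by (auto intro: square_integrable_add)

lift_definition uminus_L2 :: "L2 \<Rightarrow> L2" is "\<lambda>f z. - f z"
  using square_integrable_scale[of _ "-1"] by auto

lift_definition scaleR_L2 :: "real \<Rightarrow> L2 \<Rightarrow> L2" is "\<lambda>c f z. of_real c * f z"
  using square_integrable_scale by auto

definition minus_L2 :: "L2 \<Rightarrow> L2 \<Rightarrow> L2" where "minus_L2 f g = f + - g"

definition inner_L2 :: "L2 \<Rightarrow> L2 \<Rightarrow> real" where "inner_L2 f g = Re (cinner f g)"

definition norm_L2 :: "L2 \<Rightarrow> real" where "norm_L2 f = sqrt (inner f f)"

definition sgn_L2 :: "L2 \<Rightarrow> L2" where "sgn_L2 f = scaleR (inverse (norm f)) f"

definition dist_L2 :: "L2 \<Rightarrow> L2 \<Rightarrow> real" where "dist_L2 f g = norm (f - g)"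

definition uniformity_L2 :: "(L2 \<times> L2) filter" where
  "uniformity_L2 = (INF e\<in>{0<..}. principal {(x, y). dist x y < e})"

definition open_L2 :: "L2 set \<Rightarrow> bool" where
  "open_L2 U \<longleftrightarrow> (\<forall>x\<in>U. \<forall>\<^sub>F (x', y) in uniformity. x' = x \<longrightarrow> y \<in> U)"

lemma cinner_add_left_aux: "cinner (f + g) h = cinner f h + cinner g h"
  by transfer (simp add: distrib_right square_integrable_mult)

lemma cinner_commute_aux: "cinner f g = cnj (cinner g f)"
proof transfer
  fix f g :: "complex \<Rightarrow> complex"
  have "(LINT z|circle. f z * cnj (g z)) = (LINT z|circle. cnj (g z * cnj (f z)))"
    by (simp add: mult.commute)
  also have "\<dots> = cnj (LINT z|circle. g z * cnj (f z))"
    by (rule Bochner_Integration.integral_cnj)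
  finally show "(LINT z|circle. f z * cnj (g z)) = cnj (LINT z|circle. g z * cnj (f z))" .
qed

lemma cinner_scaleR_aux: "cinner (c *\<^sub>R f) g = of_real c * cinner f g"
  by transfer (simp add: mult.assoc)

lemma cinner_self_aux:
  "Re (cinner f f) \<ge> 0 \<and> (Re (cinner f f) = 0 \<longleftrightarrow> f = 0)"
proof transfer
  fix f :: "complex \<Rightarrow> complex"
  assume "square_integrable f \<and> square_integrable f \<and> (AE z in circle. f z = f z)"
  then have f: "square_integrable f" by simp
  have 0: "(LINT z|circle. f z * cnj (f z)) = of_real (LINT z|circle. (norm (f z))\<^sup>2)"
    by (simp add: complex_norm_square[symmetric] flip: integral_complex_of_real)
  have int: "integrable circle (\<lambda>z. (norm (f z))\<^sup>2)"
    using f by (simp add: square_integrable_def)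
  have "(LINT z|circle. (norm (f z))\<^sup>2) = 0 \<longleftrightarrow> (AE z in circle. f z = 0)"
    using integral_nonneg_eq_0_iff_AE[OF int] by simp
  moreover have "square_integrable (\<lambda>z. 0)" by (simp add: square_integrable_def)
  ultimately show "0 \<le> Re (LINT z|circle. f z * cnj (f z)) \<and>
      (Re (LINT z|circle. f z * cnj (f z)) = 0 \<longleftrightarrow>
       square_integrable f \<and> square_integrable (\<lambda>z. 0) \<and> (AE z in circle. f z = 0))"
    using f by (simp add: 0)
qed

instance
proof
  fix f g h :: L2 and a b :: real
  show "f + g + h = f + (g + h)"
    by transfer (auto simp: add.assoc intro!: square_integrable_add)
  show "f + g = g + f"
    by transfer (auto simp: add.commute intro!: square_integrable_add)
  show "0 + f = f"
    by transfer auto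
  show "- f + f = 0"
    by transfer (auto simp: square_integrable_def)
  show "f - g = f + - g"
    by (fact minus_L2_def)
  show "a *\<^sub>R (f + g) = a *\<^sub>R f + a *\<^sub>R g"
    by transfer (auto simp: distrib_left intro!: square_integrable_add square_integrable_scale)
  show "(a + b) *\<^sub>R f = a *\<^sub>R f + b *\<^sub>R f"
    by transfer
      (auto simp: distrib_right
        intro!: square_integrable_add square_integrable_scale)
  show "a *\<^sub>R b *\<^sub>R f = (a * b) *\<^sub>R f"
    by transfer (auto simp: mult.assoc intro!: square_integrable_scale simp flip: of_real_mult)
  show "1 *\<^sub>R f = f"
    by transfer auto
  show "sgn f = scaleR (inverse (norm f)) f"
    by (fact sgn_L2_def)
  show "dist f g = norm (f - g)"
    by (fact dist_L2_def)
  show "inner f g = inner g f"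
    unfolding inner_L2_def by (subst cinner_commute_aux) simp
  show "inner (f + g) h = inner f h + inner g h"
    by (simp add: inner_L2_def cinner_add_left_aux)
  show "inner (a *\<^sub>R f) g = a * inner f g"
    by (simp add: inner_L2_def cinner_scaleR_aux)
  show "0 \<le> inner f f" "inner f f = 0 \<longleftrightarrow> f = 0"
    using cinner_self_aux[of f] by (simp_all add: inner_L2_def)
  show "norm f = sqrt (inner f f)"
    by (fact norm_L2_def)
qed (fact uniformity_L2_def open_L2_def)+

end

instantiation Linf :: comm_ring_1
begin

lift_definition zero_Linf :: Linf is "\<lambda>z. 0"
  by (simp add: ess_bounded_const)

lift_definition one_Linf :: Linf is "\<lambda>z. 1"
  by (simp add: ess_bounded_const)

lift_definition plus_Linf :: "Linf \<Rightarrow> Linf \<Rightarrow> Linf" is "\<lambda>f g z. f z + g z"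
  by (auto intro: ess_bounded_add)

lift_definition times_Linf :: "Linf \<Rightarrow> Linf \<Rightarrow> Linf" is "\<lambda>f g z. f z * g z"
  by (auto intro: ess_bounded_mult)

lift_definition uminus_Linf :: "Linf \<Rightarrow> Linf" is "\<lambda>f z. - f z"
  by (auto simp: ess_bounded_def)

definition minus_Linf :: "Linf \<Rightarrow> Linf \<Rightarrow> Linf" where "minus_Linf f g = f + - g"

instance
proof
  fix f g h :: Linf
  show "f + g + h = f + (g + h)"
    by transfer (auto simp: add.assoc intro!: ess_bounded_add)
  show "f + g = g + f"
    by transfer (auto simp: add.commute intro!: ess_bounded_add)
  show "0 + f = f"
    by transfer auto
  show "- f + f = 0"
    by transfer (auto simp: ess_bounded_const)
  show "f - g = f + - g"
    by (fact minus_Linf_def)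
  show "f * g * h = f * (g * h)"
    by transfer (auto simp: mult.assoc intro!: ess_bounded_mult)
  show "f * g = g * f"
    by transfer (auto simp: mult.commute intro!: ess_bounded_mult)
  show "1 * f = f"
    by transfer auto
  show "(f + g) * h = f * h + g * h"
    by transfer (auto simp: distrib_right intro!: ess_bounded_mult ess_bounded_add)
  show "(0::Linf) \<noteq> 1"
    by transfer (simp add: not_AE_circle_False)
qed

end

lift_definition conj_Linf :: "Linf \<Rightarrow> Linf" is "\<lambda>f z. cnj (f z)"
  by (auto simp: ess_bounded_def)

lift_definition mult_op :: "Linf \<Rightarrow> L2 \<Rightarrow> L2" (infixr "\<cdot>" 75) is "\<lambda>\<phi> f z. \<phi> z * f z"
  by (auto intro: square_integrable_mult_bounded)

text \<open>Multiplication by a complex scalar is multiplication by a constant function.\<close>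

lift_definition const_Linf :: "complex \<Rightarrow> Linf" is "\<lambda>c z. c"
  by (simp add: ess_bounded_const)

section \<open>Hardy space and inner functions\<close>

text \<open>Functions on the disk are identified with their radial boundary functions.\<close>

definition radial_limit :: "(complex \<Rightarrow> complex) \<Rightarrow> (complex \<Rightarrow> complex) \<Rightarrow> bool" where
  "radial_limit F f \<longleftrightarrow>
     (AE z in circle. ((\<lambda>r. F (of_real r * z)) \<longlongrightarrow> f z) (at_left (1::real)))"

lemma radial_limit_cong_AE:
  assumes "AE z in circle. f z = g z"
  shows "radial_limit F f \<longleftrightarrow> radial_limit F g"
proof -
  have "radial_limit F g" if "radial_limit F f" "AE z in circle. f z = g z" for f g
    using that(2,1) unfolding radial_limit_def by eventually_elim auto
  moreover have "AE z in circle. g z = f z"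
    using assms by eventually_elim auto
  ultimately show ?thesis using assms by blast
qed

lift_definition boundary_L2 :: "(complex \<Rightarrow> complex) \<Rightarrow> L2 \<Rightarrow> bool" is radial_limit
  using radial_limit_cong_AE by blast

lift_definition boundary_Linf :: "(complex \<Rightarrow> complex) \<Rightarrow> Linf \<Rightarrow> bool" is radial_limit
  using radial_limit_cong_AE by blast

definition hardy2_disk :: "(complex \<Rightarrow> complex) set" where
  "hardy2_disk = {F. F holomorphic_on ball 0 1 \<and>
     (\<exists>M. \<forall>r\<in>{0..<1}. (LINT z|circle. (norm (F (of_real r * z)))\<^sup>2) \<le> M)}"

definition H2 :: "L2 set" where
  "H2 = {f. \<exists>F\<in>hardy2_disk. boundary_L2 F f}"

lift_definition unimodular :: "Linf \<Rightarrow> bool" is "\<lambda>f. AE z in circle. norm (f z) = 1"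
proof -
  fix f g :: "complex \<Rightarrow> complex"
  assume "ess_bounded f \<and> ess_bounded g \<and> (AE z in circle. f z = g z)"
  then have "AE z in circle. f z = g z" by simp
  then have "AE z in circle. norm (f z) = 1 \<longleftrightarrow> norm (g z) = 1"
    by eventually_elim auto
  then show "(AE z in circle. norm (f z) = 1) \<longleftrightarrow> (AE z in circle. norm (g z) = 1)"
    by (rule eventually_subst)
qed

definition inner_function :: "Linf \<Rightarrow> bool" where
  "inner_function \<theta> \<longleftrightarrow>
     (\<exists>F. F holomorphic_on ball 0 1 \<and> bounded (F ` ball 0 1) \<and> boundary_Linf F \<theta>) \<and> unimodular \<theta>"

section \<open>Projections, model spaces and operators\<close>

definition orth_compl :: "L2 set \<Rightarrow> L2 set" where
  "orth_compl S = {f. \<forall>g\<in>S. cinner f g = 0}"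

definition orth_proj :: "L2 set \<Rightarrow> L2 \<Rightarrow> L2" where
  "orth_proj S f = (THE g. g \<in> S \<and> f - g \<in> orth_compl S)"

definition H2_minus :: "L2 set" where
  "H2_minus = orth_compl H2"

definition P_plus :: "L2 \<Rightarrow> L2" where
  "P_plus = orth_proj H2"

definition P_minus :: "L2 \<Rightarrow> L2" where
  "P_minus f = f - P_plus f"

definition K_space :: "Linf \<Rightarrow> L2 set" where
  "K_space \<theta> = H2 \<inter> orth_compl ((\<lambda>f. \<theta> \<cdot> f) ` H2)"

definition K_perp :: "Linf \<Rightarrow> L2 set" where
  "K_perp \<theta> = orth_compl (K_space \<theta>)"

definition Q_proj :: "Linf \<Rightarrow> L2 \<Rightarrow> L2" where
  "Q_proj \<theta> = orth_proj (K_perp \<theta>)"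

text \<open>The operator \<open>D\<close> has domain \<^term>\<open>K_perp \<theta>\<close>; its values elsewhere play no role,
  and its kernel is taken inside that domain.\<close>

definition D_op :: "Linf \<Rightarrow> Linf \<Rightarrow> Linf \<Rightarrow> L2 \<Rightarrow> L2" where
  "D_op \<phi> \<theta> \<alpha> f = Q_proj \<alpha> (\<phi> \<cdot> f)"

definition ker_D :: "Linf \<Rightarrow> Linf \<Rightarrow> Linf \<Rightarrow> L2 set" where
  "ker_D \<phi> \<theta> \<alpha> = {f \<in> K_perp \<theta>. D_op \<phi> \<theta> \<alpha> f = 0}"

definition matrix_op :: "Linf^2^2 \<Rightarrow> L2^2 \<Rightarrow> L2^2" where
  "matrix_op A u = (\<chi> i. \<Sum>j\<in>UNIV. (A $ i $ j) \<cdot> (u $ j))"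

definition paired_op :: "Linf^2^2 \<Rightarrow> Linf^2^2 \<Rightarrow> L2^2 \<Rightarrow> L2^2" where
  "paired_op A B u = matrix_op A (\<chi> i. P_plus (u $ i)) + matrix_op B (\<chi> i. P_minus (u $ i))"

definition ker_op :: "(L2^2 \<Rightarrow> L2^2) \<Rightarrow> (L2^2) set" where
  "ker_op T = {u. T u = 0}"

text \<open>Isomorphism between complex subspaces of \<^typ>\<open>L2\<close> and \<^typ>\<open>L2^2\<close> (the latter with
  the Hilbert sum norm): a complex-linear homeomorphism, that is, a bounded bijective linear map
  with bounded inverse.\<close>

definition isomorphism_on :: "L2 set \<Rightarrow> (L2^2) set \<Rightarrow> (L2 \<Rightarrow> L2^2) \<Rightarrow> bool" where
  "isomorphism_on V W N \<longleftrightarrow>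
     (\<forall>f\<in>V. \<forall>g\<in>V. N (f + g) = N f + N g) \<and>
     (\<forall>c. \<forall>f\<in>V. N (const_Linf c \<cdot> f) = (\<chi> i. const_Linf c \<cdot> (N f $ i))) \<and>
     (\<exists>N'. homeomorphism V W N N')"

end

theory Submission
  imports Defs
begin

text \<open>Write an element of \<open>(K\<^sub>\<theta>)\<^sup>\<bottom>\<close> as \<open>f = f\<^sub>- + \<theta> f\<^sub>+\<close> with \<open>f\<^sub>-\<close> in \<open>H\<^sup>2\<^sub>-\<close> and \<open>f\<^sub>+\<close> in \<open>H\<^sup>2\<close>.
The projection \<open>Q\<^sub>\<alpha>\<close> kills \<open>\<phi> f\<close> exactly when \<open>\<phi> f\<close> lies in \<open>K\<^sub>\<alpha>\<close>, that is, when \<open>\<phi> f \<in> H\<^sup>2\<close> and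
\<open>\<alpha>\<^sup>* \<phi> f \<in> H\<^sup>2\<^sub>-\<close>, where \<open>\<alpha>\<^sup>*\<close> is the complex conjugate of \<open>\<alpha>\<close> (lemma \<open>ker_D_iff\<close>). On the other side, put
\<open>f = P\<^sup>- u\<^sub>1 + \<theta> P\<^sup>+ u\<^sub>1\<close>; the two rows of \<open>(A P\<^sup>+ + B P\<^sup>-) u = 0\<close> then say \<open>P\<^sup>+ u\<^sub>2 = \<phi> f\<close> and
\<open>P\<^sup>- u\<^sub>2 = \<alpha>\<^sup>* \<phi> f\<close> (lemma \<open>ker_paired_op_iff\<close>). A function \<open>u\<^sub>2\<close> with these two parts exists precisely
under the condition found for \<open>f\<close>, and it is then \<open>\<phi> (1 + \<alpha>\<^sup>*) f\<close>. So the two kernels correspond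
through \<open>f \<leftrightarrow> u\<close>, with inverse map \<open>u \<mapsto> P\<^sup>- u\<^sub>1 + \<theta> P\<^sup>+ u\<^sub>1\<close>, and both directions are built from the bounded
operators \<open>P\<^sup>+\<close>, \<open>P\<^sup>-\<close> and multiplications.

This argument rests on the existence of the orthogonal projections. For \<open>K\<^sub>\<theta>\<close> it reduces to that of \<open>P\<^sup>+\<close>,
because \<open>f \<mapsto> P\<^sup>+ f - \<theta> P\<^sup>+ (\<theta>\<^sup>* P\<^sup>+ f)\<close> is the projection onto \<open>K\<^sub>\<theta>\<close> (lemma \<open>K_space_decomposition\<close>). For
\<open>H\<^sup>2\<close> itself it is the analytic core, since \<open>H\<^sup>2\<close> is given by radial boundary values, and from that
description it is not clear that it is closed. The key is lemma \<open>H2_eq_power_series\<close>: \<open>H\<^sup>2\<close> consists of the \<open>L\<^sup>2\<close> sums of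
the series \<open>\<Sum> a\<^sub>n z\<^sup>n\<close> with \<open>\<Sum> |a\<^sub>n|\<^sup>2 < \<infinity>\<close>. Given completeness of \<open>L\<^sup>2\<close>, the projection onto \<open>H\<^sup>2\<close> is then the
nonnegative part of the Fourier series, by Bessel's inequality.

The description by power series needs Parseval's identity on the circles of radius \<open>r < 1\<close> and Fatou's theorem
(\<open>radial_limit_power_series\<close>): if \<open>g\<close> is the \<open>L\<^sup>2\<close> sum of \<open>\<Sum> a\<^sub>n z\<^sup>n\<close>, the power series
converges radially to \<open>g\<close> almost everywhere. To prove it, let \<open>G\<close> be the primitive \<open>\<Sum> a\<^sub>n z\<^sup>n\<^sup>+\<^sup>1 / (n + 1)\<close>, which is
continuous up to the boundary. On the circle it is an indefinite integral of \<open>g\<close>, so by Lebesgue's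
differentiation theorem its derivative along the circle is \<open>g\<close> almost everywhere. At a point of differentiability
the radial limit of \<open>G'\<close> is that derivative (\<open>radial_derivative_limit\<close>), because Cauchy's formula for \<open>G'\<close> can be
written with a kernel that is controlled by the Poisson kernel.\<close>

section \<open>Arc length on the circle\<close>

lemma measurable_cis_circle: "cis \<in> measurable borel circle"
proof -
  have "cis \<in> borel_measurable borel"
    by (intro borel_measurable_continuous_onI continuous_intros)
  then show ?thesis
    unfolding circle_def by (simp, intro measurable_restrict_space2) auto
qed

lemma circle_eq_distr: "circle = distr (uniform_measure lborel {0..2*pi}) circle cis"
  unfolding circle_def by (rule distr_cong) auto

lemma measurable_cis_uniform: "cis \<in> measurable (uniform_measure lborel {0..2*pi}) circle"
  using measurable_cis_circle by (simp cong: measurable_cong_sets)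

lemma borel_measurable_comp_cis:
  "f \<in> borel_measurable circle \<Longrightarrow> (\<lambda>t. f (cis t)) \<in> borel_measurable borel"
  using measurable_compose[OF measurable_cis_circle] by blast

lemma cis_Arg2pi: "norm w = 1 \<Longrightarrow> cis (Arg2pi w) = w"
  using Arg2pi_eq[of w, symmetric] by (simp add: cis_conv_exp)

text \<open>The argument, a Borel inverse of \<^const>\<open>cis\<close>, carries null sets of angles to null sets of the circle.
It jumps at \<open>1\<close>, but it is continuous on the closed upper and on the open lower half of the circle.\<close>
lemma measurable_Arg2pi_circle: "Arg2pi \<in> borel_measurable circle"
proof -
  have "Arg2pi \<in> borel_measurable (restrict_space borel (sphere 0 1))"
  proof (rule measurable_piecewise_restrict[where C = "{{z. Im z \<ge> 0}, {z. Im z < 0}}"])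
    fix \<Omega> assume \<Omega>: "\<Omega> \<in> {{z::complex. Im z \<ge> 0}, {z. Im z < 0}}"
    then have "\<Omega> \<in> sets borel"
      using borel_closed[OF closed_halfspace_Im_ge[of 0]] borel_open[OF open_halfspace_Im_lt[of 0]] by blast
    then show "\<Omega> \<inter> space (restrict_space borel (sphere 0 1)) \<in> sets (restrict_space borel (sphere 0 1))"
      unfolding sets_restrict_space space_restrict_space by (intro image_eqI[of _ _ \<Omega>]) auto
    have "continuous_on ({z. Im z \<ge> 0} \<inter> sphere 0 1) Arg2pi"
      by (rule continuous_on_subset[OF continuous_on_upperhalf_Arg2pi]) auto
    moreover have "continuous_on ({z. Im z < 0} \<inter> sphere 0 1) Arg2pi"
      by (intro continuous_at_imp_continuous_on ballI continuous_at_Arg2pi)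
         (auto simp: complex_nonneg_Reals_iff)
    ultimately show "Arg2pi \<in> borel_measurable (restrict_space (restrict_space borel (sphere 0 1)) \<Omega>)"
      using \<Omega>
      by (auto simp: restrict_restrict_space Int_commute intro!: borel_measurable_continuous_on_restrict)
  qed auto
  then show ?thesis by (simp add: circle_def cong: measurable_cong_sets)
qed

text \<open>The image under \<^const>\<open>cis\<close> of the exceptional set of angles may fail to be measurable. So that set is first
enclosed in a Borel null set \<open>N\<close>, which is then pulled back along the argument.\<close>
lemma AE_circleI:
  assumes "AE t in lborel. t \<in> {0..2*pi} \<longrightarrow> P (cis t)"
  shows "AE z in circle. P z"
proof -
  obtain N where N: "N \<in> null_sets lborel" "{t. \<not> (t \<in> {0..2*pi} \<longrightarrow> P (cis t))} \<subseteq> N"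
    using assms by (auto elim!: AE_E simp: null_sets_def)
  have "AE z in distr (uniform_measure lborel {0..2*pi}) circle cis. Arg2pi z \<notin> N"
  proof (subst AE_distr_iff[OF measurable_cis_uniform])
    show "{x \<in> space circle. Arg2pi x \<notin> N} \<in> sets circle"
      using measurable_sets[OF measurable_Arg2pi_circle, of "- N"] N(1)
      by (auto simp: vimage_def Int_def conj_commute)
    have "AE t in lborel. t \<notin> N \<and> t \<noteq> 2*pi"
      using N(1) by (auto intro: AE_not_in AE_lborel_singleton)
    then have "AE t in lborel. t \<in> {0..2*pi} \<longrightarrow> Arg2pi (cis t) \<notin> N"
      by eventually_elim (auto simp: cis_conv_exp Arg2pi_exp)
    then show "AE t in uniform_measure lborel {0..2*pi}. Arg2pi (cis t) \<notin> N"
      by (intro AE_uniform_measureI) auto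
  qed
  then have "AE z in circle. Arg2pi z \<notin> N"
    unfolding circle_eq_distr[symmetric] .
  moreover have "AE z in circle. z \<in> sphere 0 1"
    using AE_space[of circle] by simp
  ultimately show ?thesis
  proof eventually_elim
    case (elim z)
    then have "cis (Arg2pi z) = z" by (intro cis_Arg2pi) simp
    moreover have "Arg2pi z \<in> {0..2*pi}"
      using Arg2pi_ge_0[of z] Arg2pi_lt_2pi[of z] by auto
    then have "P (cis (Arg2pi z))" using N(2) elim by blast
    ultimately show ?case by (simp only:)
  qed
qed

lemma uniform_measure_circle_density:
  "uniform_measure lborel {0..2*pi} = density lborel (\<lambda>t. ennreal (indicator {0..2*pi} t / (2*pi)))"
proof -
  have "1 / ennreal (2*pi) = ennreal (1 / (2*pi))"
    using divide_ennreal[of 1 "2*pi"] by simp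
  then show ?thesis
    unfolding uniform_measure_def by (intro density_cong) (auto split: split_indicator)
qed

lemma integrable_circle_iff:
  fixes f :: "complex \<Rightarrow> 'b :: {banach, second_countable_topology}"
  assumes "f \<in> borel_measurable circle"
  shows "integrable circle f \<longleftrightarrow> set_integrable lborel {0..2*pi} (\<lambda>t. f (cis t))"
proof -
  have "integrable circle f \<longleftrightarrow> integrable (uniform_measure lborel {0..2*pi}) (\<lambda>t. f (cis t))"
    using integrable_distr_eq[OF measurable_cis_uniform assms] circle_eq_distr by simp
  also have "\<dots> \<longleftrightarrow> integrable lborel (\<lambda>t. (indicator {0..2*pi} t / (2*pi)) *\<^sub>R f (cis t))"
    unfolding uniform_measure_circle_density using borel_measurable_comp_cis[OF assms]
    by (subst integrable_density) auto
  also have "\<dots> \<longleftrightarrow> integrable lborel (\<lambda>t. (1/(2*pi)) *\<^sub>R (indicator {0..2*pi} t *\<^sub>R f (cis t)))"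
    by simp
  also have "\<dots> \<longleftrightarrow> set_integrable lborel {0..2*pi} (\<lambda>t. f (cis t))"
  proof
    assume "integrable lborel (\<lambda>t. (1/(2*pi)) *\<^sub>R (indicator {0..2*pi} t *\<^sub>R f (cis t)))"
    from integrable_scaleR_right[OF this, of "2*pi"]
    show "set_integrable lborel {0..2*pi} (\<lambda>t. f (cis t))"
      by (simp add: set_integrable_def)
  next
    assume "set_integrable lborel {0..2*pi} (\<lambda>t. f (cis t))"
    then show "integrable lborel (\<lambda>t. (1/(2*pi)) *\<^sub>R (indicator {0..2*pi} t *\<^sub>R f (cis t)))"
      unfolding set_integrable_def by (rule integrable_scaleR_right)
  qed
  finally show ?thesis .
qed

lemma integral_circle:
  fixes f :: "complex \<Rightarrow> 'b :: {banach, second_countable_topology}"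
  assumes "f \<in> borel_measurable circle"
  shows "(LINT z|circle. f z) = (1/(2*pi)) *\<^sub>R (LINT t:{0..2*pi}|lborel. f (cis t))"
proof -
  have "(LINT z|circle. f z) = (LINT t|uniform_measure lborel {0..2*pi}. f (cis t))"
    using integral_distr[OF measurable_cis_uniform assms] circle_eq_distr by simp
  also have "\<dots> = (LINT t|lborel. (indicator {0..2*pi} t / (2*pi)) *\<^sub>R f (cis t))"
    unfolding uniform_measure_circle_density using borel_measurable_comp_cis[OF assms]
    by (subst integral_density) auto
  also have "\<dots> = (LINT t|lborel. (1/(2*pi)) *\<^sub>R (indicator {0..2*pi} t *\<^sub>R f (cis t)))"
    by simp
  finally show ?thesis
    unfolding set_lebesgue_integral_def by (subst (asm) integral_scaleR_right) auto
qed

lemma continuous_measurable_circle: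
  fixes f :: "complex \<Rightarrow> 'b::topological_space"
  assumes "continuous_on (sphere 0 1) f"
  shows "f \<in> borel_measurable circle"
  using borel_measurable_continuous_on_restrict[OF assms]
  by (simp add: circle_def cong: measurable_cong_sets)

lemma integral_power_orthonormal:
  "(LINT z|circle. z ^ n * cnj (z ^ m)) = (if n = m then 1 else 0)"
proof -
  define k where "k = real n - real m"
  have cis_eq: "cis t ^ n * cnj (cis t) ^ m = cis (k * t)" for t
    unfolding cis_cnj Complex.DeMoivre cis_mult
    by (rule arg_cong[where f = cis]) (simp add: k_def algebra_simps)
  have "(LINT z|circle. z ^ n * cnj (z ^ m)) = (1/(2*pi)) *\<^sub>R (LINT t:{0..2*pi}|lborel. cis (k * t))"
    by (subst integral_circle)
       (auto simp: cis_eq intro!: continuous_measurable_circle continuous_intros)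
  also have "(LINT t:{0..2*pi}|lborel. cis (k * t)) = (if n = m then of_real (2*pi) else 0)"
  proof (cases "n = m")
    case True
    then show ?thesis by (simp add: k_def set_lebesgue_integral_def scaleR_conv_of_real)
  next
    case False
    then have "k \<noteq> 0" by (simp add: k_def)
    have "(LINT t:{0..2*pi}|lborel. cis (k * t)) = cis (k * (2*pi)) / (\<i> * k) - cis (k * 0) / (\<i> * k)"
      unfolding set_lebesgue_integral_def
    proof (rule integral_FTC_Icc)
      fix x assume "0 \<le> x" "x \<le> 2*pi"
      have "((\<lambda>w. exp (\<i> * k * w) / (\<i> * k)) has_field_derivative exp (\<i> * k * x)) (at (of_real x))"
        using \<open>k \<noteq> 0\<close> by (auto intro!: derivative_eq_intros)
      from has_vector_derivative_real_field[OF this]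
      show "((\<lambda>x. cis (k * x) / (\<i> * k)) has_vector_derivative cis (k * x)) (at x within {0..2*pi})"
        by (simp add: cis_conv_exp mult_ac)
    qed (auto intro!: continuous_intros)
    also have "cis (k * (2*pi)) = 1"
    proof -
      have "cis (k * (2*pi)) = cis (2*pi*real_of_int (int n - int m))"
        by (simp add: k_def algebra_simps)
      then show ?thesis by (simp only: cis_multiple_2pi Ints_of_int)
    qed
    finally show ?thesis using False by simp
  qed
  finally show ?thesis by (simp add: scaleR_conv_of_real)
qed

section \<open>Completeness of \<open>L\<^sup>2\<close>\<close>

lemma L2_cases: obtains f where "square_integrable f" "F = abs_L2 f"
  by (induction F rule: L2.abs_induct) auto

lemma Linf_cases: obtains f where "ess_bounded f" "F = abs_Linf f"
  by (induction F rule: Linf.abs_induct) auto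

lemma abs_L2_plus: "square_integrable f \<Longrightarrow> square_integrable g \<Longrightarrow> abs_L2 f + abs_L2 g = abs_L2 (\<lambda>z. f z + g z)"
  by (simp add: plus_L2.abs_eq)

lemma square_integrable_uminus: "square_integrable f \<Longrightarrow> square_integrable (\<lambda>z. - f z)"
  by (simp add: square_integrable_def)

lemma square_integrable_diff:
  "square_integrable f \<Longrightarrow> square_integrable g \<Longrightarrow> square_integrable (\<lambda>z. f z - g z)"
  using square_integrable_add[OF _ square_integrable_uminus, of f g] by simp

lemma abs_L2_diff: "square_integrable f \<Longrightarrow> square_integrable g \<Longrightarrow> abs_L2 f - abs_L2 g = abs_L2 (\<lambda>z. f z - g z)"
  by (simp add: minus_L2_def uminus_L2.abs_eq abs_L2_plus square_integrable_uminus)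

lemma cinner_abs_L2:
  "square_integrable f \<Longrightarrow> square_integrable g \<Longrightarrow> cinner (abs_L2 f) (abs_L2 g) = (LINT z|circle. f z * cnj (g z))"
  by (simp add: cinner.abs_eq)

lemma mult_op_abs:
  "ess_bounded f \<Longrightarrow> square_integrable g \<Longrightarrow> abs_Linf f \<cdot> abs_L2 g = abs_L2 (\<lambda>z. f z * g z)"
  by (simp add: mult_op.abs_eq)

lemma abs_L2_eq_iff:
  "square_integrable f \<Longrightarrow> square_integrable g \<Longrightarrow> abs_L2 f = abs_L2 g \<longleftrightarrow> (AE z in circle. f z = g z)"
  using Quotient3_rel[OF Quotient3_L2, of f g] by auto

lemma square_integrable_bounded: "ess_bounded f \<Longrightarrow> square_integrable f"
  using square_integrable_mult_bounded[of f "\<lambda>_. 1"] by (simp add: square_integrable_def)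

lemma ess_bounded_continuous:
  assumes "continuous_on (sphere 0 1) f"
  shows "ess_bounded f"
proof -
  have "bounded (f ` sphere 0 1)"
    using assms by (intro compact_imp_bounded compact_continuous_image) auto
  then obtain C where "\<forall>z\<in>sphere 0 1. norm (f z) \<le> C"
    unfolding bounded_iff by blast
  then have "AE z in circle. norm (f z) \<le> C"
    by (intro AE_I2) (simp only: space_circle)
  then show ?thesis
    using continuous_measurable_circle[OF assms] by (auto simp: ess_bounded_def)
qed

lemma norm_abs_L2:
  assumes "square_integrable f"
  shows "(norm (abs_L2 f))\<^sup>2 = (LINT z|circle. (norm (f z))\<^sup>2)"
proof -
  have "(norm (abs_L2 f))\<^sup>2 = Re (cinner (abs_L2 f) (abs_L2 f))"
    by (simp add: norm_eq_sqrt_inner inner_L2_def del: real_sqrt_ge_0_iff) (simp flip: inner_L2_def)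
  also have "\<dots> = Re (of_real (LINT z|circle. (norm (f z))\<^sup>2))"
    using assms by (simp add: cinner_abs_L2 complex_norm_square[symmetric] flip: integral_complex_of_real)
  finally show ?thesis by simp
qed

text \<open>The Cauchy--Schwarz inequality against the constant \<open>1\<close>, whose norm is \<open>1\<close> for normalized arc length.\<close>
lemma integral_norm_le_L2_norm:
  assumes "square_integrable f"
  shows "integrable circle f" "(LINT z|circle. norm (f z)) \<le> norm (abs_L2 f)"
proof -
  define g where "g = (\<lambda>z. complex_of_real (norm (f z)))"
  have g: "square_integrable g" and one: "square_integrable (\<lambda>z. 1)"
    using assms by (auto simp: square_integrable_def g_def)
  have "integrable circle (\<lambda>z. f z * cnj 1)"
    by (rule square_integrable_mult[OF assms one])
  then show "integrable circle f" by simp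
  have "(LINT z|circle. norm (f z)) = inner (abs_L2 g) (abs_L2 (\<lambda>z. 1))"
    by (simp add: inner_L2_def cinner_abs_L2[OF g one]) (simp add: g_def)
  also have "\<dots> \<le> norm (abs_L2 g) * norm (abs_L2 (\<lambda>z. 1))"
    by (rule norm_cauchy_schwarz)
  also have "norm (abs_L2 (\<lambda>z. 1)) = 1"
  proof -
    have "(norm (abs_L2 (\<lambda>z. 1)))\<^sup>2 = measure circle (space circle)"
      by (simp only: norm_abs_L2[OF one]) simp
    also have "\<dots> = 1" by (simp add: measure_def emeasure_circle)
    finally show ?thesis
      using power2_eq_imp_eq[of "norm (abs_L2 (\<lambda>z. 1))" 1] by simp
  qed
  also have "norm (abs_L2 g) = norm (abs_L2 f)"
    by (rule power2_eq_imp_eq) (simp_all only: norm_abs_L2[OF g] norm_abs_L2[OF assms] norm_ge_zero, simp add: g_def)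
  finally show "(LINT z|circle. norm (f z)) \<le> norm (abs_L2 f)" by simp
qed

text \<open>Fatou's lemma on integrals: a bound on the norms survives pointwise limits. Applied to the differences with a fixed term of
a Cauchy sequence, it turns pointwise convergence into convergence in \<open>L\<^sup>2\<close>.\<close>
lemma square_integrable_AE_limit:
  assumes x: "\<And>n. square_integrable (x n)"
    and lim: "AE z in circle. (\<lambda>n. x n z) \<longlonglongrightarrow> g z"
    and g: "g \<in> borel_measurable circle"
    and le: "eventually (\<lambda>n. (LINT z|circle. (norm (x n z))\<^sup>2) \<le> C) sequentially"
  shows "square_integrable g" "(LINT z|circle. (norm (g z))\<^sup>2) \<le> C"
proof -
  have meas [measurable]: "\<And>n. x n \<in> borel_measurable circle" using x by (auto simp: square_integrable_def)
  obtain n0 where n0: "\<And>n. n \<ge> n0 \<Longrightarrow> (LINT z|circle. (norm (x n z))\<^sup>2) \<le> C"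
    using le by (auto simp: eventually_sequentially)
  have "0 \<le> (LINT z|circle. (norm (x n0 z))\<^sup>2)" by simp
  also have "\<dots> \<le> C" by (simp add: n0)
  finally have "C \<ge> 0" .
  have "(\<integral>\<^sup>+z. ennreal ((norm (g z))\<^sup>2) \<partial>circle)
        = (\<integral>\<^sup>+z. liminf (\<lambda>n. ennreal ((norm (x (n + n0) z))\<^sup>2)) \<partial>circle)"
  proof (rule nn_integral_cong_AE)
    from lim show "AE z in circle. ennreal ((norm (g z))\<^sup>2) = liminf (\<lambda>n. ennreal ((norm (x (n + n0) z))\<^sup>2))"
    proof eventually_elim
      case (elim z)
      then have "(\<lambda>n. x (n + n0) z) \<longlonglongrightarrow> g z" by (rule LIMSEQ_ignore_initial_segment)
      then have "(\<lambda>n. ennreal ((norm (x (n + n0) z))\<^sup>2)) \<longlonglongrightarrow> ennreal ((norm (g z))\<^sup>2)"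
        by (intro tendsto_intros)
      then show ?case by (intro lim_imp_Liminf[symmetric]) (rule trivial_limit_sequentially)
    qed
  qed
  also have "\<dots> \<le> liminf (\<lambda>n. \<integral>\<^sup>+z. ennreal ((norm (x (n + n0) z))\<^sup>2) \<partial>circle)"
    by (rule nn_integral_liminf) simp
  also have "\<dots> \<le> ennreal C"
  proof (rule Liminf_le)
    have "(\<integral>\<^sup>+z. ennreal ((norm (x (n + n0) z))\<^sup>2) \<partial>circle) \<le> ennreal C" for n
      using x[of "n + n0"] n0[of "n + n0"]
      by (subst nn_integral_eq_integral) (auto simp: square_integrable_def intro!: ennreal_leI)
    then show "\<forall>\<^sub>F n in sequentially. (\<integral>\<^sup>+z. ennreal ((norm (x (n + n0) z))\<^sup>2) \<partial>circle) \<le> ennreal C"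
      by simp
  qed simp
  finally have bound: "(\<integral>\<^sup>+z. ennreal ((norm (g z))\<^sup>2) \<partial>circle) \<le> ennreal C" .
  then have int: "integrable circle (\<lambda>z. (norm (g z))\<^sup>2)"
    using g by (intro integrableI_bounded) (auto intro: order_le_less_trans simp: ennreal_less_top)
  then show "square_integrable g" using g by (simp add: square_integrable_def)
  show "(LINT z|circle. (norm (g z))\<^sup>2) \<le> C"
    using bound \<open>C \<ge> 0\<close> by (subst (asm) nn_integral_eq_integral[OF int]) auto
qed

text \<open>The theorem of Riesz and Fischer. A Cauchy sequence in \<open>L\<^sup>2\<close> is Cauchy in \<open>L\<^sup>1\<close>, hence a subsequence has a
pointwise limit almost everywhere, and Fatou's lemma bounds the distance of that limit to the sequence.\<close>
lemma L2_Cauchy_convergent: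
  fixes X :: "nat \<Rightarrow> L2"
  assumes "Cauchy X"
  shows "convergent X"
proof -
  have "\<exists>f. square_integrable f \<and> X n = abs_L2 f" for n
    using L2_cases[of "X n"] by metis
  then obtain x where x: "\<And>n. square_integrable (x n)" and X: "\<And>n. X n = abs_L2 (x n)" by metis
  have L1: "(LINT z|circle. norm (x i z - x j z)) \<le> dist (X i) (X j)" for i j
    using integral_norm_le_L2_norm(2)[OF square_integrable_diff[OF x x], of i j]
    by (simp add: X dist_norm abs_L2_diff[OF x x])
  obtain r where r: "strict_mono r" and ae: "AE z in circle. Cauchy (\<lambda>i. x (r i) z)"
  proof (rule cauchy_L1_AE_cauchy_subseq[of circle x])
    show "integrable circle (x n)" for n by (rule integral_norm_le_L2_norm[OF x])
    show "\<exists>N. \<forall>i\<ge>N. \<forall>j\<ge>N. (LINT z|circle. norm (x i z - x j z)) < e" if "e > 0" for e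
      using metric_CauchyD[OF assms that] L1 by (meson le_less_trans)
  qed
  define g where "g = (\<lambda>z. lim (\<lambda>i. x (r i) z))"
  have meas [measurable]: "\<And>n. x n \<in> borel_measurable circle" using x by (auto simp: square_integrable_def)
  have g_meas: "g \<in> borel_measurable circle" unfolding g_def by measurable
  have lim: "AE z in circle. (\<lambda>i. x (r i) z) \<longlonglongrightarrow> g z"
    using ae by eventually_elim (simp add: g_def Cauchy_convergent_iff convergent_LIMSEQ_iff)
  have close: "square_integrable (\<lambda>z. g z - x m z) \<and> (LINT z|circle. (norm (g z - x m z))\<^sup>2) \<le> e\<^sup>2"
    if e: "\<And>i. i \<ge> m \<Longrightarrow> dist (X i) (X m) < e" for m e
  proof -
    have "AE z in circle. (\<lambda>i. x (r i) z - x m z) \<longlonglongrightarrow> g z - x m z"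
      using lim by eventually_elim (intro tendsto_intros)
    moreover have "eventually (\<lambda>i. (LINT z|circle. (norm (x (r i) z - x m z))\<^sup>2) \<le> e\<^sup>2) sequentially"
      unfolding eventually_sequentially
    proof (intro exI allI impI)
      fix i assume "m \<le> i"
      then have "r i \<ge> m" using seq_suble[OF r, of i] by linarith
      have "(LINT z|circle. (norm (x (r i) z - x m z))\<^sup>2) = (dist (X (r i)) (X m))\<^sup>2"
        by (simp add: X dist_norm abs_L2_diff[OF x x] norm_abs_L2[OF square_integrable_diff[OF x x]])
      also have "\<dots> \<le> e\<^sup>2"
        using e[OF \<open>r i \<ge> m\<close>] by (intro power_mono) auto
      finally show "(LINT z|circle. (norm (x (r i) z - x m z))\<^sup>2) \<le> e\<^sup>2" .
    qed
    ultimately show ?thesis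
      using square_integrable_AE_limit[of "\<lambda>i z. x (r i) z - x m z" "\<lambda>z. g z - x m z" "e\<^sup>2"]
        square_integrable_diff[OF x x] g_meas meas by simp
  qed
  obtain m1 where "\<And>i. i \<ge> m1 \<Longrightarrow> dist (X i) (X m1) < 1"
    using metric_CauchyD[OF assms, of 1] by auto
  then have "square_integrable (\<lambda>z. (g z - x m1 z) + x m1 z)"
    using close x by (intro square_integrable_add) auto
  then have g: "square_integrable g" by simp
  have "X \<longlonglongrightarrow> abs_L2 g"
  proof (rule metric_LIMSEQ_I)
    fix e :: real assume "e > 0"
    then obtain M where M: "\<And>i m. i \<ge> M \<Longrightarrow> m \<ge> M \<Longrightarrow> dist (X i) (X m) < e/2"
      using metric_CauchyD[OF assms, of "e/2"] by auto
    have "dist (X m) (abs_L2 g) < e" if "m \<ge> M" for m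
    proof -
      have "(LINT z|circle. (norm (g z - x m z))\<^sup>2) \<le> (e/2)\<^sup>2"
        using close[of m "e/2"] M that by auto
      then have "(dist (abs_L2 g) (X m))\<^sup>2 \<le> (e/2)\<^sup>2"
        by (simp add: X dist_norm abs_L2_diff[OF g x] norm_abs_L2[OF square_integrable_diff[OF g x]])
      then have "dist (abs_L2 g) (X m) \<le> e/2"
        by (rule power2_le_imp_le) (use \<open>e > 0\<close> in simp)
      then show ?thesis using \<open>e > 0\<close> by (simp add: dist_commute)
    qed
    then show "\<exists>M. \<forall>m\<ge>M. dist (X m) (abs_L2 g) < e" by blast
  qed
  then show ?thesis by (rule convergentI)
qed

instance L2 :: banach
  by standard (rule L2_Cauchy_convergent)

section \<open>Multiplication operators and the inner product\<close>

lemma mult_op_mult: "(\<phi> * \<psi>) \<cdot> f = \<phi> \<cdot> (\<psi> \<cdot> f)"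
  by transfer (auto simp: mult.assoc intro!: square_integrable_mult_bounded)

lemma mult_op_one [simp]: "1 \<cdot> f = f"
  by transfer auto

lemma mult_op_add_left: "(\<phi> + \<psi>) \<cdot> f = \<phi> \<cdot> f + \<psi> \<cdot> f"
  by transfer (auto simp: distrib_right intro!: square_integrable_mult_bounded square_integrable_add)

lemma mult_op_uminus_left: "(- \<phi>) \<cdot> f = - (\<phi> \<cdot> f)"
  by transfer (auto intro!: square_integrable_mult_bounded square_integrable_uminus)

lemma mult_op_zero_left [simp]: "0 \<cdot> f = 0"
  by transfer (auto simp: square_integrable_def)

lemma mult_op_add: "\<phi> \<cdot> (f + g) = \<phi> \<cdot> f + \<phi> \<cdot> g"
  by transfer (auto simp: distrib_left intro!: square_integrable_mult_bounded square_integrable_add)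

lemma mult_op_scaleR: "\<phi> \<cdot> (r *\<^sub>R f) = r *\<^sub>R (\<phi> \<cdot> f)"
proof transfer
  fix \<phi> f :: "complex \<Rightarrow> complex" and r :: real
  assume \<phi>: "ess_bounded \<phi> \<and> ess_bounded \<phi> \<and> (AE z in circle. \<phi> z = \<phi> z)"
    and f: "square_integrable f \<and> square_integrable f \<and> (AE z in circle. f z = f z)"
  have "square_integrable (\<lambda>z. of_real r * (\<phi> z * f z))"
    using \<phi> f by (intro square_integrable_scale square_integrable_mult_bounded) auto
  then show "square_integrable (\<lambda>z. \<phi> z * (of_real r * f z)) \<and>
      square_integrable (\<lambda>z. of_real r * (\<phi> z * f z)) \<and>
      (AE z in circle. \<phi> z * (of_real r * f z) = of_real r * (\<phi> z * f z))"
    by (simp add: mult_ac)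
qed

lemma mult_op_bounded_linear: "bounded_linear (mult_op \<phi>)"
proof -
  obtain p where p: "ess_bounded p" "\<phi> = abs_Linf p" by (rule Linf_cases)
  obtain C where C: "AE z in circle. norm (p z) \<le> C" using p by (auto simp: ess_bounded_def)
  have "norm (\<phi> \<cdot> F) \<le> norm F * \<bar>C\<bar>" for F
  proof -
    obtain f where f: "square_integrable f" "F = abs_L2 f" by (rule L2_cases)
    have pf: "square_integrable (\<lambda>z. p z * f z)" by (rule square_integrable_mult_bounded[OF p(1) f(1)])
    have "(norm (\<phi> \<cdot> F))\<^sup>2 = (LINT z|circle. (norm (p z * f z))\<^sup>2)"
      by (simp only: p(2) f(2) mult_op_abs[OF p(1) f(1)] norm_abs_L2[OF pf])
    also have "\<dots> \<le> (LINT z|circle. C\<^sup>2 * (norm (f z))\<^sup>2)"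
    proof (rule integral_mono_AE)
      show "AE z in circle. (norm (p z * f z))\<^sup>2 \<le> C\<^sup>2 * (norm (f z))\<^sup>2"
        using C by eventually_elim (auto simp: norm_mult power_mult_distrib intro!: mult_right_mono power_mono)
    qed (use pf f in \<open>auto simp: square_integrable_def\<close>)
    also have "\<dots> = (norm F * \<bar>C\<bar>)\<^sup>2"
      using f by (simp add: norm_abs_L2[OF f(1)] power_mult_distrib mult.commute)
    finally show ?thesis by (rule power2_le_imp_le) simp
  qed
  then show ?thesis
    by (intro bounded_linear_intro[where K = "\<bar>C\<bar>"]) (auto simp: mult_op_add mult_op_scaleR)
qed

lemma mult_op_diff: "\<phi> \<cdot> (f - g) = \<phi> \<cdot> f - \<phi> \<cdot> g"
  by (rule linear_diff[OF bounded_linear.linear[OF mult_op_bounded_linear]])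

lemma cinner_mult_op: "cinner (\<phi> \<cdot> f) g = cinner f (conj_Linf \<phi> \<cdot> g)"
  by transfer (simp add: mult_ac)

lemma conj_Linf_conj [simp]: "conj_Linf (conj_Linf \<phi>) = \<phi>"
  by transfer simp

lemma unimodular_conj_mult: "unimodular \<theta> \<Longrightarrow> conj_Linf \<theta> * \<theta> = 1"
proof transfer
  fix f :: "complex \<Rightarrow> complex"
  assume f: "ess_bounded f \<and> ess_bounded f \<and> (AE z in circle. f z = f z)" and "AE z in circle. cmod (f z) = 1"
  have "AE z in circle. cnj (f z) * f z = 1"
    using \<open>AE z in circle. cmod (f z) = 1\<close>
    by eventually_elim (metis complex_norm_square mult.commute of_real_1 one_power2)
  then show "ess_bounded (\<lambda>z. cnj (f z) * f z) \<and> ess_bounded (\<lambda>z. 1) \<and> (AE z in circle. cnj (f z) * f z = 1)"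
    using f ess_bounded_mult[of "\<lambda>z. cnj (f z)" f] by (auto simp: ess_bounded_const ess_bounded_def)
qed

lemma cinner_const: "cinner (const_Linf c \<cdot> f) g = c * cinner f g"
  by transfer (simp add: mult.assoc)

lemma const_Linf_mult: "const_Linf (c * d) = const_Linf c * const_Linf d"
  by transfer (auto simp: ess_bounded_const)

lemmas cinner_add_left = cinner_add_left_aux
lemmas cinner_commute = cinner_commute_aux

lemma cinner_add_right: "cinner f (g + h) = cinner f g + cinner f h"
  by (subst (1 2 3) cinner_commute) (simp add: cinner_add_left)

lemma cinner_minus_left: "cinner (- f) g = - cinner f g"
  using cinner_scaleR_aux[of "-1" f g] by simp

lemma cinner_diff_left: "cinner (f - g) h = cinner f h - cinner g h"
  using cinner_add_left[of f "-g" h] by (simp add: cinner_minus_left)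

lemma cinner_zero_left [simp]: "cinner 0 g = 0"
  using cinner_diff_left[of 0 0 g] by simp

lemma cinner_zero_right [simp]: "cinner f 0 = 0"
  by (subst cinner_commute) simp

lemma cinner_const_right: "cinner f (const_Linf c \<cdot> g) = cnj c * cinner f g"
  by (subst (1 2) cinner_commute) (simp add: cinner_const)

lemma cinner_sum_left: "cinner (\<Sum>i\<in>A. f i) g = (\<Sum>i\<in>A. cinner (f i) g)"
  by (induction A rule: infinite_finite_induct) (auto simp: cinner_add_left)

lemma cinner_sum_right: "cinner g (\<Sum>i\<in>A. f i) = (\<Sum>i\<in>A. cinner g (f i))"
  by (induction A rule: infinite_finite_induct) (auto simp: cinner_add_right)

lemma cinner_self: "cinner f f = of_real ((norm f)\<^sup>2)"
proof (rule complex_eqI)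
  show "Re (cinner f f) = Re (of_real ((norm f)\<^sup>2))"
    by (simp add: power2_norm_eq_inner inner_L2_def)
  show "Im (cinner f f) = Im (of_real ((norm f)\<^sup>2))"
    using arg_cong[OF cinner_commute[of f f], of Im] by simp
qed

lemma cinner_self_eq_0_iff: "cinner f f = 0 \<longleftrightarrow> f = 0"
  by (simp add: cinner_self del: of_real_power)

text \<open>The real inner product is the real part of \<^const>\<open>cinner\<close>, and the imaginary part is the real inner product
with \<open>- \<i> f\<close>; bounding the two parts separately costs a factor \<open>2\<close>, which is harmless for continuity.\<close>
lemma bounded_linear_cinner_left: "bounded_linear (\<lambda>f. cinner f g)"
proof (rule bounded_linear_intro[where K = "2 * norm g"])
  show "cinner (x + y) g = cinner x g + cinner y g" for x y by (rule cinner_add_left)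
  show "cinner (r *\<^sub>R x) g = r *\<^sub>R cinner x g" for r x
    by (simp add: cinner_scaleR_aux scaleR_conv_of_real)
  fix f
  have "norm (const_Linf (- \<i>) \<cdot> f) = norm f"
  proof -
    have "cinner (const_Linf (- \<i>) \<cdot> f) (const_Linf (- \<i>) \<cdot> f) = cinner f f"
      by (simp add: cinner_const cinner_const_right del: complex_cnj_minus) simp
    then have "(norm (const_Linf (- \<i>) \<cdot> f))\<^sup>2 = (norm f)\<^sup>2"
      unfolding cinner_self of_real_eq_iff .
    then show ?thesis by (rule power2_eq_imp_eq) simp_all
  qed
  moreover have "Im (cinner f g) = inner (const_Linf (- \<i>) \<cdot> f) g"
    by (simp add: inner_L2_def cinner_const)
  ultimately have "\<bar>Im (cinner f g)\<bar> \<le> norm f * norm g"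
    using Cauchy_Schwarz_ineq2[of "const_Linf (- \<i>) \<cdot> f" g] by simp
  moreover have "\<bar>Re (cinner f g)\<bar> \<le> norm f * norm g"
    using Cauchy_Schwarz_ineq2[of f g] by (simp add: inner_L2_def)
  ultimately show "norm (cinner f g) \<le> norm f * (2 * norm g)"
    using cmod_le[of "cinner f g"] by simp
qed

section \<open>Power series in \<open>L\<^sup>2\<close>\<close>

lemma pythagoras: "cinner f g = 0 \<Longrightarrow> (norm (f + g))\<^sup>2 = (norm f)\<^sup>2 + (norm g)\<^sup>2"
  by (simp add: power2_norm_eq_inner inner_add inner_commute[of g f]) (simp add: inner_L2_def)

definition zpow :: "nat \<Rightarrow> L2" where "zpow n = abs_L2 (\<lambda>z. z ^ n)"

lemma square_integrable_continuous: "continuous_on (sphere 0 1) f \<Longrightarrow> square_integrable f"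
  by (intro square_integrable_bounded ess_bounded_continuous)

lemma cinner_zpow: "cinner (zpow n) (zpow m) = (if n = m then 1 else 0)"
  unfolding zpow_def
  by (subst cinner_abs_L2) (auto intro!: square_integrable_continuous continuous_intros
        simp: integral_power_orthonormal simp del: complex_cnj_power)

lemma const_mult_zpow: "const_Linf c \<cdot> zpow n = abs_L2 (\<lambda>z. c * z ^ n)"
  unfolding zpow_def const_Linf.abs_eq
  by (rule mult_op_abs) (auto intro!: ess_bounded_const square_integrable_continuous continuous_intros)

lemma polynomial_L2: "finite A \<Longrightarrow> (\<Sum>n\<in>A. const_Linf (a n) \<cdot> zpow n) = abs_L2 (\<lambda>z. \<Sum>n\<in>A. a n * z ^ n)"
proof (induction A rule: finite_induct)
  case empty
  then show ?case by (simp add: zero_L2.abs_eq)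
next
  case (insert n A)
  then show ?case
    by (simp add: const_mult_zpow)
       (intro abs_L2_plus square_integrable_continuous continuous_intros)
qed

lemma cinner_polynomial_zpow:
  "finite A \<Longrightarrow> cinner (\<Sum>n\<in>A. const_Linf (a n) \<cdot> zpow n) (zpow m) = (if m \<in> A then a m else 0)"
  by (simp add: cinner_sum_left cinner_const cinner_zpow if_distrib[of "\<lambda>x. _ * x"] sum.delta' cong: if_cong)

lemma norm_polynomial:
  assumes "finite A"
  shows "(norm (\<Sum>n\<in>A. const_Linf (a n) \<cdot> zpow n))\<^sup>2 = (\<Sum>n\<in>A. (norm (a n))\<^sup>2)"
proof -
  let ?p = "\<Sum>n\<in>A. const_Linf (a n) \<cdot> zpow n"
  have "complex_of_real ((norm ?p)\<^sup>2) = cinner ?p ?p"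
    by (rule cinner_self[symmetric])
  also have "\<dots> = (\<Sum>m\<in>A. cnj (a m) * cinner ?p (zpow m))"
    unfolding cinner_sum_right[of ?p] cinner_const_right ..
  also have "\<dots> = (\<Sum>m\<in>A. cnj (a m) * a m)"
    by (intro sum.cong refl) (simp add: cinner_polynomial_zpow[OF assms])
  also have "\<dots> = of_real (\<Sum>n\<in>A. (norm (a n))\<^sup>2)"
    unfolding of_real_sum complex_norm_square by (simp add: mult.commute)
  finally show ?thesis unfolding of_real_eq_iff .
qed

text \<open>By orthonormality the squared norms of the blocks of the series are blocks of \<open>\<Sum> |a\<^sub>n|\<^sup>2\<close>, so Cauchy's
criterion carries over.\<close>
lemma L2_power_series_summable:
  assumes "summable (\<lambda>n. (norm (a n))\<^sup>2)"
  shows "summable (\<lambda>n. const_Linf (a n) \<cdot> zpow n)"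
  unfolding summable_Cauchy
proof (intro allI impI)
  fix e :: real assume "e > 0"
  then obtain N where N: "\<And>m n. m \<ge> N \<Longrightarrow> norm (\<Sum>k\<in>{m..<n}. (norm (a k))\<^sup>2) < e\<^sup>2"
    using assms[unfolded summable_Cauchy] by (meson zero_less_power)
  have "norm (\<Sum>k\<in>{m..<n}. const_Linf (a k) \<cdot> zpow k) < e" if "m \<ge> N" for m n
  proof (rule power2_less_imp_less)
    show "(norm (\<Sum>k\<in>{m..<n}. const_Linf (a k) \<cdot> zpow k))\<^sup>2 < e\<^sup>2"
      using N[OF that, of n] by (simp only: norm_polynomial finite_atLeastLessThan) (simp add: sum_nonneg)
  qed (use \<open>e > 0\<close> in simp)
  then show "\<exists>N. \<forall>m\<ge>N. \<forall>n. norm (\<Sum>k\<in>{m..<n}. const_Linf (a k) \<cdot> zpow k) < e" by blast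
qed

lemma cinner_power_series_zpow:
  assumes "(\<lambda>n. const_Linf (a n) \<cdot> zpow n) sums g"
  shows "cinner g (zpow m) = a m"
proof (rule LIMSEQ_unique)
  show "(\<lambda>N. cinner (\<Sum>n<N. const_Linf (a n) \<cdot> zpow n) (zpow m)) \<longlonglongrightarrow> cinner g (zpow m)"
    using bounded_linear.tendsto[OF bounded_linear_cinner_left] assms unfolding sums_def by blast
  have "eventually (\<lambda>N. cinner (\<Sum>n<N. const_Linf (a n) \<cdot> zpow n) (zpow m) = a m) sequentially"
    using eventually_gt_at_top[of m] by eventually_elim (simp add: cinner_polynomial_zpow)
  then show "(\<lambda>N. cinner (\<Sum>n<N. const_Linf (a n) \<cdot> zpow n) (zpow m)) \<longlonglongrightarrow> a m"
    by (rule tendsto_eventually)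
qed

text \<open>Bessel's inequality: \<open>f\<close> minus its partial Fourier sum \<open>p\<close> is orthogonal to \<open>p\<close>, so \<open>p\<close> is no longer
than \<open>f\<close>.\<close>
lemma bessel_summable: "summable (\<lambda>n. (norm (cinner f (zpow n)))\<^sup>2)"
proof (rule bounded_imp_summable)
  fix N
  define p where "p = (\<Sum>n\<in>{..N}. const_Linf (cinner f (zpow n)) \<cdot> zpow n)"
  have "cinner (f - p) (zpow m) = 0" if "m \<le> N" for m
    using that by (simp add: p_def cinner_diff_left cinner_polynomial_zpow)
  then have "cinner (f - p) p = 0"
    by (subst (2) p_def) (simp add: cinner_sum_right cinner_const_right)
  then have "(norm (f - p + p))\<^sup>2 = (norm (f - p))\<^sup>2 + (norm p)\<^sup>2" by (rule pythagoras)
  then have "(norm p)\<^sup>2 \<le> (norm f)\<^sup>2" by simp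
  then show "(\<Sum>n\<le>N. (norm (cinner f (zpow n)))\<^sup>2) \<le> (norm f)\<^sup>2"
    by (simp add: p_def norm_polynomial)
qed simp

section \<open>Radial limits of derivatives\<close>

lemma has_contour_integral_unit_circle:
  "(f has_contour_integral I) (circlepath 0 1) \<longleftrightarrow>
    ((\<lambda>t. f (cis (2*pi*t)) * (2 * of_real pi * \<i> * cis (2*pi*t))) has_integral I) {0..1}"
proof -
  have "vector_derivative (circlepath 0 1) (at t within {0..1}) = 2 * of_real pi * \<i> * cis (2*pi*t)" if "t \<in> {0..1}" for t
    using vector_derivative_circlepath01[of t 0 1] that by (simp add: cis_conv_exp mult_ac)
  moreover have "circlepath 0 1 t = cis (2*pi*t)" for t
    by (simp add: circlepath cis_conv_exp mult_ac)
  ultimately show ?thesis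
    unfolding has_contour_integral_def by (intro has_integral_cong) simp
qed

text \<open>On the unit circle \<open>1 / |w - z|\<^sup>2\<close> equals \<open>w / ((1 - z\<^sup>* w) (w - z))\<close>, where \<open>z\<^sup>*\<close> is the conjugate of \<open>z\<close>. The factor
\<open>w\<close> comes from the differential \<open>dw\<close>, so the integral is Cauchy's formula at \<open>z\<close> for the function
\<open>1 / (1 - z\<^sup>* w)\<close>, which is holomorphic around the closed disk.\<close>
lemma poisson_kernel_integral:
  assumes "norm z < 1"
  shows "((\<lambda>t. (1 - (norm z)\<^sup>2) / (norm (cis (2*pi*t) - z))\<^sup>2) has_integral 1) {0..1}"
proof -
  have nz: "1 - cnj z * w \<noteq> 0" if "norm w \<le> 1" for w
  proof -
    have "norm (cnj z * w) \<le> norm z * 1"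
      unfolding norm_mult complex_mod_cnj using that by (intro mult_left_mono) auto
    then show ?thesis using assms by auto
  qed
  have "((\<lambda>w. 1 / (1 - cnj z * w) / (w - z)) has_contour_integral (2 * of_real pi * \<i> * (1 / (1 - cnj z * z)))) (circlepath 0 1)"
    by (rule Cauchy_integral_circlepath)
       (use assms nz in \<open>auto intro!: continuous_intros holomorphic_intros\<close>)
  then have *: "((\<lambda>t. 1 / (1 - cnj z * cis (2*pi*t)) / (cis (2*pi*t) - z) * (2 * of_real pi * \<i> * cis (2*pi*t)))
      has_integral (2 * of_real pi * \<i> * (1 / (1 - cnj z * z)))) {0..1}"
    by (simp only: has_contour_integral_unit_circle)
  have eq: "1 / (1 - cnj z * w) / (w - z) * w = of_real (1 / (norm (w - z))\<^sup>2)" if "norm w = 1" for w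
  proof -
    have w: "w * cnj w = 1" using that by (simp add: complex_norm_square[symmetric])
    have "1 - cnj z * w = w * cnj (w - z)"
      using w by (simp add: algebra_simps)
    moreover have "of_real (1 / (norm (w - z))\<^sup>2) = 1 / ((w - z) * cnj (w - z))"
      by (simp add: complex_norm_square[symmetric] del: complex_cnj_diff)
    moreover have "w \<noteq> 0" using that by auto
    ultimately show ?thesis by simp
  qed
  have eq': "1 / (1 - cnj z * cis (2*pi*t)) / (cis (2*pi*t) - z) * (2 * of_real pi * \<i> * cis (2*pi*t))
      = 2 * of_real pi * \<i> * of_real (1 / (norm (cis (2*pi*t) - z))\<^sup>2)" for t
    by (subst eq[symmetric]) (simp, rule mult.left_commute)
  have Im: "Im (2 * of_real pi * \<i> * of_real y) = 2 * pi * y" for y by simp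
  have zz: "cnj z * z = of_real ((norm z)\<^sup>2)"
    by (subst complex_norm_square) (rule mult.commute)
  have "((\<lambda>t. ((1 - (norm z)\<^sup>2) / (2 * pi)) * Im (2 * of_real pi * \<i> * of_real (1 / (norm (cis (2*pi*t) - z))\<^sup>2)))
     has_integral ((1 - (norm z)\<^sup>2) / (2 * pi)) * Im (2 * of_real pi * \<i> * (1 / (1 - cnj z * z)))) {0..1}"
    by (rule has_integral_mult_right[OF has_integral_Im[OF *[unfolded eq']]])
  moreover have "((1 - (norm z)\<^sup>2) / (2 * pi)) * Im (2 * of_real pi * \<i> * (1 / (1 - cnj z * z))) = 1"
  proof -
    have "1 - (norm z)\<^sup>2 \<noteq> 0" using assms by (simp add: abs_square_eq_1)
    moreover have "Im (2 * of_real pi * \<i> * (1 / (1 - cnj z * z))) = 2 * pi * (1 / (1 - (norm z)\<^sup>2))"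
    proof -
      have "1 / (1 - cnj z * z) = of_real (1 / (1 - (norm z)\<^sup>2))" unfolding zz by simp
      then show ?thesis by (simp only: Im)
    qed
    ultimately show ?thesis by simp
  qed
  moreover have "(\<lambda>t. ((1 - (norm z)\<^sup>2) / (2 * pi)) * Im (2 * of_real pi * \<i> * of_real (1 / (norm (cis (2*pi*t) - z))\<^sup>2)))
     = (\<lambda>t. (1 - (norm z)\<^sup>2) / (norm (cis (2*pi*t) - z))\<^sup>2)"
    by (rule ext) (simp only: Im, simp)
  ultimately show ?thesis by (simp only:)
qed

text \<open>The Poisson kernel is nonnegative with mean value \<open>1\<close>.\<close>
lemma contour_integral_poisson_bound:
  assumes I: "(E has_contour_integral I) (circlepath 0 1)" and z: "norm z < 1"
    and bound: "\<And>w. norm w = 1 \<Longrightarrow> norm (E w) \<le> A * ((1 - (norm z)\<^sup>2) / (norm (w - z))\<^sup>2) + B"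
  shows "norm I \<le> 2 * pi * (A + B)"
proof -
  let ?P = "\<lambda>t. (1 - (norm z)\<^sup>2) / (norm (cis (2*pi*t) - z))\<^sup>2"
  have *: "((\<lambda>t. E (cis (2*pi*t)) * (2 * of_real pi * \<i> * cis (2*pi*t))) has_integral I) {0..1}"
    using I by (simp only: has_contour_integral_unit_circle)
  have P: "((\<lambda>t. 2 * pi * (A * ?P t + B)) has_integral 2 * pi * (A * 1 + B)) {0..1}"
    by (intro has_integral_mult_right has_integral_add poisson_kernel_integral z)
       (use has_integral_const_real[of B 0 1] in simp)
  have "norm (integral {0..1} (\<lambda>t. E (cis (2*pi*t)) * (2 * of_real pi * \<i> * cis (2*pi*t))))
      \<le> integral {0..1} (\<lambda>t. 2 * pi * (A * ?P t + B))"
  proof (rule integral_norm_bound_integral)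
    fix t :: real
    have "norm (E (cis (2*pi*t)) * (2 * of_real pi * \<i> * cis (2*pi*t))) = 2 * pi * norm (E (cis (2*pi*t)))"
      by (simp add: norm_mult)
    also have "\<dots> \<le> 2 * pi * (A * ?P t + B)"
      by (intro mult_left_mono bound) auto
    finally show "norm (E (cis (2*pi*t)) * (2 * of_real pi * \<i> * cis (2*pi*t))) \<le> 2 * pi * (A * ?P t + B)" .
  qed (use * P in blast)+
  then show ?thesis
    using integral_unique[OF *] integral_unique[OF P] by simp
qed

text \<open>The left-hand side is the kernel \<open>1 / (w - z)\<^sup>2\<close> at \<open>z = r \<zeta>\<close> minus the same kernel at the reflected point \<open>\<zeta> / r\<close>. As
\<open>|w - \<zeta> / r| = |w - z| / r\<close> on the circle, the difference is of size \<open>(1 - r\<^sup>2) / |w - z|\<^sup>3\<close>. Multiplied by a function of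
order \<open>|w - \<zeta>|\<close>, it is therefore bounded by a multiple of the Poisson kernel, which the single kernel is not.\<close>
lemma reflected_kernel_bound:
  fixes w \<zeta> :: complex
  assumes w: "norm w = 1" and \<zeta>: "norm \<zeta> = 1" and r: "0 < r" "r < 1"
  shows "norm (1 / (w - of_real r * \<zeta>)\<^sup>2 - (of_real r)\<^sup>2 / (of_real r * w - \<zeta>)\<^sup>2)
     \<le> 2 * (1 - r\<^sup>2) / (norm (w - of_real r * \<zeta>)) ^ 3"
proof -
  define a where "a = w - of_real r * \<zeta>"
  define b where "b = of_real r * w - \<zeta>"
  have "(norm b)\<^sup>2 = (norm a)\<^sup>2"
  proof -
    have "(Re w)\<^sup>2 + (Im w)\<^sup>2 = 1" "(Re \<zeta>)\<^sup>2 + (Im \<zeta>)\<^sup>2 = 1"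
      using w \<zeta> by (simp_all flip: cmod_power2)
    then show ?thesis
      unfolding a_def b_def cmod_power2 by simp algebra
  qed
  then have ba: "norm b = norm a" by (rule power2_eq_imp_eq) auto
  have "norm a \<ge> norm w - norm (of_real r * \<zeta>)" unfolding a_def by (rule norm_triangle_ineq2)
  then have "norm a \<ge> 1 - r" using assms by (simp add: norm_mult)
  then have a: "norm a > 0" using r by linarith
  then have nz: "a \<noteq> 0" "b \<noteq> 0" using ba by auto
  have "1 / a\<^sup>2 - (of_real r)\<^sup>2 / b\<^sup>2 = (b\<^sup>2 - (of_real r)\<^sup>2 * a\<^sup>2) / (a\<^sup>2 * b\<^sup>2)"
    using nz by (simp add: field_simps)
  also have "b\<^sup>2 - (of_real r)\<^sup>2 * a\<^sup>2 = - of_real (1 - r\<^sup>2) * \<zeta> * (b + of_real r * a)"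
    unfolding a_def b_def by (simp add: algebra_simps power2_eq_square)
  finally have "norm (1 / a\<^sup>2 - (of_real r)\<^sup>2 / b\<^sup>2) = (\<bar>1 - r\<^sup>2\<bar> * norm (b + of_real r * a)) / (norm a) ^ 4"
    by (simp only: norm_divide norm_mult norm_minus_cancel norm_of_real norm_power ba \<zeta>)
       (simp add: power2_eq_square power4_eq_xxxx)
  also have "\<dots> \<le> ((1 - r\<^sup>2) * (2 * norm a)) / (norm a) ^ 4"
  proof (intro divide_right_mono mult_mono)
    have "r\<^sup>2 \<le> 1" using r by (simp add: power_le_one)
    then show "\<bar>1 - r\<^sup>2\<bar> \<le> 1 - r\<^sup>2" "0 \<le> 1 - r\<^sup>2" by auto
    have "norm (b + of_real r * a) \<le> norm b + norm (of_real r * a)" by (rule norm_triangle_ineq)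
    also have "\<dots> \<le> 2 * norm a" using r ba by (simp add: norm_mult mult_left_le_one_le)
    finally show "norm (b + of_real r * a) \<le> 2 * norm a" .
  qed auto
  also have "\<dots> = 2 * (1 - r\<^sup>2) / (norm a) ^ 3"
    using a by (simp add: field_simps eval_nat_numeral)
  finally show ?thesis unfolding a_def b_def .
qed

text \<open>Cauchy's formula expresses \<open>2 \<pi> \<i> H'(z)\<close> by the kernel \<open>1 / (w - z)\<^sup>2\<close>. The kernel at the reflected point
integrates to \<open>0\<close> against \<open>H\<close>, so it may be subtracted. Close to \<open>\<zeta>\<close> the
factor \<open>|w - \<zeta>| \<le> 2 |w - z|\<close> cancels one power of the distance and leaves a multiple of the Poisson kernel; away
from \<open>\<zeta>\<close> the kernel is at most a constant times \<open>1 - r\<^sup>2\<close>.\<close>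
lemma radial_derivative_bound:
  fixes H :: "complex \<Rightarrow> complex"
  assumes cont: "continuous_on (cball 0 1) H" and holo: "H holomorphic_on ball 0 1"
    and \<zeta>: "norm \<zeta> = 1" and r: "0 < r" "r < 1" and "\<delta> > 0"
    and near: "\<And>w. norm w = 1 \<Longrightarrow> norm (w - \<zeta>) < \<delta> \<Longrightarrow> norm (H w) \<le> e * norm (w - \<zeta>)"
    and far: "\<And>w. norm w = 1 \<Longrightarrow> norm (H w) \<le> M"
    and "e \<ge> 0"
  shows "norm (deriv H (of_real r * \<zeta>)) \<le> 4 * e + 16 * M / \<delta> ^ 3 * (1 - r\<^sup>2)"
proof -
  define z where "z = of_real r * \<zeta>"
  have z: "norm z = r" using \<zeta> r by (simp add: z_def norm_mult)
  have "M \<ge> 0" using far[OF \<zeta>] norm_ge_zero[of "H \<zeta>"] by linarith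
  have nz: "of_real r * u - \<zeta> \<noteq> 0" if "norm u \<le> 1" for u
  proof -
    have "norm (of_real r * u) \<le> r * 1"
      unfolding norm_mult using that r by (intro mult_mono) auto
    then show ?thesis using \<zeta> r by auto
  qed
  have 1: "((\<lambda>u. H u / (u - z) ^ Suc 1) has_contour_integral ((2 * of_real pi * \<i>) / fact 1 * (deriv ^^ 1) H z)) (circlepath 0 1)"
    using Cauchy_has_contour_integral_higher_derivative_circlepath[OF cont holo, of z 1] z r by simp
  have 2: "((\<lambda>u. (u * H u * (of_real r)\<^sup>2 / (of_real r * u - \<zeta>)\<^sup>2) / (u - 0)) has_contour_integral
      (2 * of_real pi * \<i> * (0 * H 0 * (of_real r)\<^sup>2 / (of_real r * 0 - \<zeta>)\<^sup>2))) (circlepath 0 1)"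
    by (rule Cauchy_integral_circlepath) (use cont holo nz in \<open>auto intro!: continuous_intros holomorphic_intros\<close>)
  \<comment> \<open>The second integrand is \<open>H(u) / (u - \<zeta> / r)\<^sup>2\<close>. It is written as Cauchy's formula at \<open>0\<close> for a function with the
    factor \<open>u\<close>, and so its integral vanishes.\<close>
  from has_contour_integral_diff[OF 1 2]
  have I: "((\<lambda>u. H u / (u - z) ^ Suc 1 - (u * H u * (of_real r)\<^sup>2 / (of_real r * u - \<zeta>)\<^sup>2) / (u - 0))
      has_contour_integral 2 * of_real pi * \<i> * deriv H z) (circlepath 0 1)"
    by simp
  have "norm (2 * of_real pi * \<i> * deriv H z) \<le> 2 * pi * (4 * e + 16 * M / \<delta> ^ 3 * (1 - r\<^sup>2))"
  proof (rule contour_integral_poisson_bound[OF I])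
    show "norm z < 1" using z r by simp
    fix w :: complex assume w: "norm w = 1"
    define d where "d = norm (w - z)"
    have d1: "1 - r \<le> d"
      using norm_triangle_ineq2[of w z] w z by (simp add: d_def)
    then have "d > 0" using r by linarith
    have "norm (z - \<zeta>) = 1 - r"
    proof -
      have "z - \<zeta> = - of_real (1 - r) * \<zeta>" by (simp add: z_def algebra_simps)
      then show ?thesis using \<zeta> r by (simp only: norm_mult norm_minus_cancel norm_of_real) simp
    qed
    then have d2: "norm (w - \<zeta>) \<le> 2 * d"
      using norm_triangle_ineq[of "w - z" "z - \<zeta>"] d1 by (simp add: d_def)
    have "w \<noteq> 0" using w by auto
    have r2: "1 - r\<^sup>2 \<ge> 0" using r by (simp add: power_le_one)
    define K where "K = 1 / (w - z)\<^sup>2 - (of_real r)\<^sup>2 / (of_real r * w - \<zeta>)\<^sup>2"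
    have K: "norm K \<le> 2 * (1 - r\<^sup>2) / d ^ 3"
      unfolding K_def d_def z_def by (rule reflected_kernel_bound[OF w \<zeta> r])
    have "H w / (w - z) ^ Suc 1 - (w * H w * (of_real r)\<^sup>2 / (of_real r * w - \<zeta>)\<^sup>2) / (w - 0) = H w * K"
      using \<open>w \<noteq> 0\<close> by (simp add: K_def right_diff_distrib power2_eq_square)
    moreover have "norm (H w * K) \<le> 4 * e * ((1 - r\<^sup>2) / d\<^sup>2) + 16 * M / \<delta> ^ 3 * (1 - r\<^sup>2)"
    proof (cases "norm (w - \<zeta>) < \<delta>")
      case True
      have "norm (H w) \<le> e * (2 * d)"
        using near[OF w True] d2 \<open>e \<ge> 0\<close> by (meson mult_left_mono order_trans)
      then have "norm (H w * K) \<le> (e * (2 * d)) * (2 * (1 - r\<^sup>2) / d ^ 3)"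
        unfolding norm_mult using K \<open>e \<ge> 0\<close> \<open>d > 0\<close> by (intro mult_mono) auto
      also have "\<dots> = 4 * e * ((1 - r\<^sup>2) / d\<^sup>2)"
        using \<open>d > 0\<close> by (simp add: field_simps eval_nat_numeral)
      also have "\<dots> \<le> 4 * e * ((1 - r\<^sup>2) / d\<^sup>2) + 16 * M / \<delta> ^ 3 * (1 - r\<^sup>2)"
        using \<open>M \<ge> 0\<close> \<open>\<delta> > 0\<close> r2 by simp
      finally show ?thesis .
    next
      case False
      then have "\<delta> / 2 \<le> d" using d2 by simp
      have "norm (H w * K) \<le> M * (2 * (1 - r\<^sup>2) / d ^ 3)"
        unfolding norm_mult using K far[OF w] \<open>M \<ge> 0\<close> by (intro mult_mono) auto
      also have "\<dots> \<le> M * (2 * (1 - r\<^sup>2) / (\<delta> / 2) ^ 3)"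
        using \<open>\<delta> / 2 \<le> d\<close> \<open>\<delta> > 0\<close> \<open>d > 0\<close> \<open>M \<ge> 0\<close> r2
        by (intro mult_left_mono divide_left_mono power_mono mult_pos_pos zero_less_power) auto
      also have "\<dots> = 16 * M / \<delta> ^ 3 * (1 - r\<^sup>2)"
        using \<open>\<delta> > 0\<close> by (simp add: field_simps eval_nat_numeral)
      also have "\<dots> \<le> 4 * e * ((1 - r\<^sup>2) / d\<^sup>2) + 16 * M / \<delta> ^ 3 * (1 - r\<^sup>2)"
        using \<open>e \<ge> 0\<close> r2 by simp
      finally show ?thesis .
    qed
    ultimately show "norm (H w / (w - z) ^ Suc 1 - (w * H w * (of_real r)\<^sup>2 / (of_real r * w - \<zeta>)\<^sup>2) / (w - 0))
        \<le> 4 * e * ((1 - (norm z)\<^sup>2) / (norm (w - z))\<^sup>2) + 16 * M / \<delta> ^ 3 * (1 - r\<^sup>2)"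
      by (simp only: z d_def)
  qed
  then show ?thesis by (simp add: norm_mult z_def)
qed

text \<open>Subtracting the first-order Taylor polynomial at \<open>\<zeta>\<close> from \<open>G\<close> leaves a function that is small compared with
\<open>|w - \<zeta>|\<close> on the circle near \<open>\<zeta>\<close>, and the bound above applies to it. Differentiability along the circle suffices
because only boundary values enter Cauchy's formula.\<close>
lemma radial_derivative_limit:
  fixes G :: "complex \<Rightarrow> complex"
  assumes cont: "continuous_on (cball 0 1) G" and holo: "G holomorphic_on ball 0 1"
    and \<zeta>: "norm \<zeta> = 1" and der: "(G has_field_derivative c) (at \<zeta> within sphere 0 1)"
  shows "((\<lambda>r. deriv G (of_real r * \<zeta>)) \<longlongrightarrow> c) (at_left (1::real))"
proof (rule tendstoI)
  fix \<epsilon> :: real assume "\<epsilon> > 0"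
  \<comment> \<open>With this choice the near part contributes \<open>4 e = \<epsilon> / 2\<close>.\<close>
  define e where "e = \<epsilon> / 8"
  have "e > 0" using \<open>\<epsilon> > 0\<close> by (simp add: e_def)
  define H where "H = (\<lambda>w. G w - (G \<zeta> + c * (w - \<zeta>)))"
  have contH: "continuous_on (cball 0 1) H" and holoH: "H holomorphic_on ball 0 1"
    using cont holo by (auto simp: H_def intro!: continuous_intros holomorphic_intros)
  obtain \<delta> where "\<delta> > 0"
    and \<delta>: "\<And>w. w \<in> sphere 0 1 \<Longrightarrow> norm (w - \<zeta>) < \<delta> \<Longrightarrow> norm (G w - G \<zeta> - c * (w - \<zeta>)) \<le> e * norm (w - \<zeta>)"
    using der \<open>e > 0\<close> unfolding has_field_derivative_def has_derivative_within_alt by blast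
  have "bounded (H ` sphere 0 1)"
    by (intro compact_imp_bounded compact_continuous_image continuous_on_subset[OF contH]) auto
  then obtain M where M: "\<forall>w\<in>sphere 0 1. norm (H w) \<le> M"
    unfolding bounded_iff by blast
  have lim: "((\<lambda>r. 4 * e + 16 * M / \<delta> ^ 3 * (1 - r\<^sup>2)) \<longlongrightarrow> 4 * e + 16 * M / \<delta> ^ 3 * (1 - 1\<^sup>2)) (at_left (1::real))"
    by (intro tendsto_intros)
  then have "\<forall>\<^sub>F r in at_left 1. 4 * e + 16 * M / \<delta> ^ 3 * (1 - r\<^sup>2) < \<epsilon>"
    by (rule order_tendstoD) (use \<open>\<epsilon> > 0\<close> in \<open>simp add: e_def\<close>)
  moreover have "\<forall>\<^sub>F r in at_left 1. r \<in> {0<..<1::real}"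
    by (rule eventually_at_leftI[of 0]) auto
  ultimately show "\<forall>\<^sub>F r in at_left 1. dist (deriv G (of_real r * \<zeta>)) c < \<epsilon>"
  proof eventually_elim
    case (elim r)
    have "norm (deriv H (of_real r * \<zeta>)) \<le> 4 * e + 16 * M / \<delta> ^ 3 * (1 - r\<^sup>2)"
    proof (rule radial_derivative_bound[OF contH holoH \<zeta>])
      fix w :: complex assume "norm w = 1" "norm (w - \<zeta>) < \<delta>"
      then show "norm (H w) \<le> e * norm (w - \<zeta>)"
        using \<delta>[of w] by (simp add: H_def algebra_simps)
    qed (use elim \<open>\<delta> > 0\<close> \<open>e > 0\<close> M in auto)
    moreover have "of_real r * \<zeta> \<in> ball 0 1" using elim \<zeta> by (simp add: norm_mult)
    then have "(G has_field_derivative deriv G (of_real r * \<zeta>)) (at (of_real r * \<zeta>))"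
      using holo by (simp add: holomorphic_derivI)
    then have "(H has_field_derivative deriv G (of_real r * \<zeta>) - c) (at (of_real r * \<zeta>))"
      unfolding H_def by (auto intro!: derivative_eq_intros)
    then have "deriv H (of_real r * \<zeta>) = deriv G (of_real r * \<zeta>) - c" by (rule DERIV_imp_deriv)
    ultimately show ?case using elim by (simp add: dist_norm)
  qed
qed

section \<open>Fatou's theorem for power series\<close>

text \<open>Lebesgue's differentiation theorem supplies the derivative from the right; applied to the reflected function
\<open>x \<mapsto> f (- x)\<close> it supplies the derivative from the left.\<close>
lemma indefinite_integral_derivative_AE:
  fixes f \<phi> :: "real \<Rightarrow> complex"
  assumes f: "\<And>x y. f integrable_on {x..y}"
    and \<phi>: "\<And>x y. a \<le> x \<Longrightarrow> x \<le> y \<Longrightarrow> y \<le> b \<Longrightarrow> integral {x..y} f = \<phi> y - \<phi> x"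
  obtains N where "negligible N" "\<And>t. t \<in> {a<..<b} - N \<Longrightarrow> (\<phi> has_vector_derivative f t) (at t)"
proof -
  have "f integrable_on cbox x y" for x y using f by simp
  then obtain N1 where N1: "negligible N1" and right:
    "\<And>t e. t \<notin> N1 \<Longrightarrow> 0 < e \<Longrightarrow> \<exists>d>0. \<forall>h. 0 < h \<and> h < d \<longrightarrow>
       norm (integral (cbox t (t + h *\<^sub>R One)) f /\<^sub>R h ^ DIM(real) - f t) < e"
    using integrable_ccontinuous_explicit[of f] by blast
  have "(\<lambda>x. f (- x)) integrable_on cbox x y" for x y
    using f[of "-y" "-x"] Henstock_Kurzweil_Integration.integrable_reflect_real[of f "-x" "-y"] by simp
  then obtain N2 where N2: "negligible N2" and left:
    "\<And>t e. t \<notin> N2 \<Longrightarrow> 0 < e \<Longrightarrow> \<exists>d>0. \<forall>h. 0 < h \<and> h < d \<longrightarrow>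
       norm (integral (cbox t (t + h *\<^sub>R One)) (\<lambda>x. f (- x)) /\<^sub>R h ^ DIM(real) - f (- t)) < e"
    using integrable_ccontinuous_explicit[of "\<lambda>x. f (- x)"] by blast
  have N2': "negligible (uminus ` N2)"
  proof (rule negligible_locally_Lipschitz_image[OF order_refl N2])
    fix x :: real
    show "\<exists>T B. open T \<and> x \<in> T \<and> (\<forall>y\<in>N2 \<inter> T. norm (- y - - x) \<le> B * norm (y - x))"
      by (intro exI[of _ UNIV] exI[of _ 1]) auto
  qed
  show thesis
  proof
    show "negligible (N1 \<union> uminus ` N2)" using N1 N2' by (rule negligible_Un)
    fix t assume t: "t \<in> {a<..<b} - (N1 \<union> uminus ` N2)"
    then have "- t \<notin> N2" by force
    have "\<exists>d>0. \<forall>y. norm (y - t) < d \<longrightarrow> norm (\<phi> y - \<phi> t - (y - t) *\<^sub>R f t) \<le> e * norm (y - t)" if "e > 0" for e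
    proof -
      obtain d1 where d1: "d1 > 0" "\<And>h. 0 < h \<Longrightarrow> h < d1 \<Longrightarrow> norm (integral {t..t + h} f /\<^sub>R h - f t) < e"
        using right[of t e] t \<open>e > 0\<close> by auto
      obtain d2 where d2: "d2 > 0" "\<And>h. 0 < h \<Longrightarrow> h < d2 \<Longrightarrow> norm (integral {-t..-t + h} (\<lambda>x. f (- x)) /\<^sub>R h - f t) < e"
        using left[of "-t" e] \<open>- t \<notin> N2\<close> \<open>e > 0\<close> by auto
      have scale: "norm (I - h *\<^sub>R c) \<le> e * h" if "norm (I /\<^sub>R h - c) < e" "h > 0" for I c :: complex and h
      proof -
        have "I - h *\<^sub>R c = h *\<^sub>R (I /\<^sub>R h - c)" using \<open>h > 0\<close> by (simp add: scaleR_right_diff_distrib)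
        then have "norm (I - h *\<^sub>R c) = h * norm (I /\<^sub>R h - c)" using \<open>h > 0\<close> by simp
        then show ?thesis using that by (simp add: mult.commute mult_left_mono)
      qed
      \<comment> \<open>The last two bounds keep \<open>y\<close> in \<open>[a, b]\<close>, where \<open>\<phi>\<close> is a primitive.\<close>
      define d where "d = min (min d1 d2) (min (t - a) (b - t))"
      show ?thesis
      proof (intro exI[of _ d] conjI allI impI)
        show "d > 0" using d1 d2 t by (auto simp: d_def)
        fix y assume y: "norm (y - t) < d"
        consider "y = t" | "y > t" | "y < t" by linarith
        then show "norm (\<phi> y - \<phi> t - (y - t) *\<^sub>R f t) \<le> e * norm (y - t)"
        proof cases
          case 2
          then have "integral {t..t + (y - t)} f = \<phi> y - \<phi> t"
            using \<phi>[of t y] t y by (auto simp: d_def)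
          then show ?thesis
            using scale[OF d1(2)[of "y - t"]] 2 y by (auto simp: d_def)
        next
          case 3
          have "integral {-t..-t + (t - y)} (\<lambda>x. f (- x)) = \<phi> t - \<phi> y"
            using \<phi>[of y t] t y 3 Henstock_Kurzweil_Integration.integral_reflect_real[of t y f]
            by (auto simp: d_def)
          then have "norm (\<phi> t - \<phi> y - (t - y) *\<^sub>R f t) \<le> e * (t - y)"
            using scale[OF d2(2)[of "t - y"]] 3 y by (auto simp: d_def)
          moreover have "\<phi> y - \<phi> t - (y - t) *\<^sub>R f t = - (\<phi> t - \<phi> y - (t - y) *\<^sub>R f t)"
            by (simp add: algebra_simps)
          ultimately show ?thesis using 3 by (simp only: norm_minus_cancel) simp
        qed simp
      qed
    qed
    then show "(\<phi> has_vector_derivative f t) (at t)"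
      unfolding has_vector_derivative_def has_derivative_within_alt
      by (auto intro: bounded_linear_scaleR_left)
  qed
qed

lemma cis_has_vector_derivative: "(cis has_vector_derivative \<i> * cis t) (at t)"
proof -
  have "((\<lambda>w. exp (\<i> * w)) has_field_derivative \<i> * exp (\<i> * t)) (at (of_real t))"
    by (auto intro!: derivative_eq_intros)
  from has_vector_derivative_real_field[OF this] show ?thesis
    by (simp add: cis_conv_exp[abs_def])
qed

text \<open>The difference quotient along the circle is the quotient of the difference quotients of \<open>G \<circ> cis\<close> and of
\<^const>\<open>cis\<close> in the angle. The angle is continuous away from \<open>1\<close>, which is why the endpoints of the interval are excluded.\<close>
lemma field_derivative_along_circle:
  assumes t: "t \<in> {0<..<2*pi}"
    and der: "((\<lambda>s. G (cis s)) has_vector_derivative \<i> * cis t * c) (at t)"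
  shows "(G has_field_derivative c) (at (cis t) within sphere 0 1)"
proof -
  have quot: "((\<lambda>s. (\<phi> s - \<phi> t) / of_real (s - t)) \<longlongrightarrow> D) (at t)"
    if "(\<phi> has_vector_derivative D) (at t)" for \<phi> :: "real \<Rightarrow> complex" and D
  proof -
    have "((\<lambda>s. (1 / norm (s - t)) *\<^sub>R (\<phi> s - (\<phi> t + (s - t) *\<^sub>R D))) \<longlongrightarrow> 0) (at t)"
      using that unfolding has_vector_derivative_def has_derivative_within by blast
    then have "((\<lambda>s. norm ((1 / norm (s - t)) *\<^sub>R (\<phi> s - (\<phi> t + (s - t) *\<^sub>R D)))) \<longlongrightarrow> 0) (at t)"
      by (rule tendsto_norm_zero)
    then have "((\<lambda>s. norm ((\<phi> s - \<phi> t) / of_real (s - t) - D)) \<longlongrightarrow> 0) (at t)"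
    proof (rule Lim_transform_eventually)
      have "norm ((1 / norm (s - t)) *\<^sub>R (\<phi> s - (\<phi> t + (s - t) *\<^sub>R D))) = norm ((\<phi> s - \<phi> t) / of_real (s - t) - D)"
        if "s \<noteq> t" for s
      proof -
        have "(\<phi> s - \<phi> t) / of_real (s - t) - D = (\<phi> s - (\<phi> t + (s - t) *\<^sub>R D)) / of_real (s - t)"
          using that by (simp add: field_simps scaleR_conv_of_real)
        then have "norm ((\<phi> s - \<phi> t) / of_real (s - t) - D) = norm (\<phi> s - (\<phi> t + (s - t) *\<^sub>R D)) / \<bar>s - t\<bar>"
          by (simp only: norm_divide norm_of_real)
        then show ?thesis by simp
      qed
      then show "\<forall>\<^sub>F s in at t. norm ((1 / norm (s - t)) *\<^sub>R (\<phi> s - (\<phi> t + (s - t) *\<^sub>R D)))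
          = norm ((\<phi> s - \<phi> t) / of_real (s - t) - D)"
        unfolding eventually_at_filter by simp
    qed
    then show ?thesis by (rule Lim_null[THEN iffD2, OF tendsto_norm_zero_cancel])
  qed
  have "((\<lambda>s. ((G (cis s) - G (cis t)) / of_real (s - t)) / ((cis s - cis t) / of_real (s - t))) \<longlongrightarrow> (\<i> * cis t * c) / (\<i> * cis t)) (at t)"
    by (intro tendsto_divide quot der cis_has_vector_derivative) auto
  moreover have "(\<i> * cis t * c) / (\<i> * cis t) = c" by simp
  ultimately have "((\<lambda>s. ((G (cis s) - G (cis t)) / of_real (s - t)) / ((cis s - cis t) / of_real (s - t))) \<longlongrightarrow> c) (at t)"
    by (simp only:)
  then have lim: "((\<lambda>s. (G (cis s) - G (cis t)) / (cis s - cis t)) \<longlongrightarrow> c) (at t)"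
  proof (rule Lim_transform_eventually)
    show "\<forall>\<^sub>F s in at t. ((G (cis s) - G (cis t)) / of_real (s - t)) / ((cis s - cis t) / of_real (s - t))
        = (G (cis s) - G (cis t)) / (cis s - cis t)"
      unfolding eventually_at_filter by simp
  qed
  have Arg_t: "Arg2pi (cis t) = t"
    using Arg2pi_exp[of "\<i> * t"] t by (simp add: cis_conv_exp)
  have "filterlim Arg2pi (at t) (at (cis t) within sphere 0 1)"
    unfolding filterlim_at
  proof
    have "cis t \<notin> \<real>\<^sub>\<ge>\<^sub>0"
      using Arg_t t Arg2pi_eq_0[of "cis t"] by (auto simp: complex_nonneg_Reals_iff complex_is_Real_iff)
    then have "isCont Arg2pi (cis t)" by (rule continuous_at_Arg2pi)
    then show "(Arg2pi \<longlongrightarrow> t) (at (cis t) within sphere 0 1)"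
      using Arg_t by (metis isCont_def tendsto_within_subset subset_UNIV)
    show "\<forall>\<^sub>F w in at (cis t) within sphere 0 1. Arg2pi w \<in> UNIV \<and> Arg2pi w \<noteq> t"
      unfolding eventually_at_filter
      by (intro always_eventually allI impI) (use cis_Arg2pi in auto)
  qed
  from filterlim_compose[OF lim this]
  have "((\<lambda>w. (G (cis (Arg2pi w)) - G (cis t)) / (cis (Arg2pi w) - cis t)) \<longlongrightarrow> c) (at (cis t) within sphere 0 1)" .
  then have "((\<lambda>w. (G w - G (cis t)) / (w - cis t)) \<longlongrightarrow> c) (at (cis t) within sphere 0 1)"
    by (rule Lim_transform_eventually) (auto simp: eventually_at_filter cis_Arg2pi)
  then show ?thesis by (simp add: has_field_derivative_iff)
qed

text \<open>On the circle \<open>dz = \<i> z dt\<close>, so these are the integrals \<open>\<integral> h(z) dz\<close> over arcs. Their bound by the norm of \<open>h\<close> lets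
\<open>L\<^sup>2\<close> limits pass to boundary values of primitives.\<close>
lemma arc_integrable_bound:
  assumes h: "square_integrable h"
  shows "set_integrable lborel {0..2*pi} (\<lambda>s. \<i> * cis s * h (cis s))"
    and "0 \<le> x \<Longrightarrow> y \<le> 2*pi \<Longrightarrow> norm (integral {x..y} (\<lambda>s. \<i> * cis s * h (cis s))) \<le> 2 * pi * norm (abs_L2 h)"
proof -
  define k where "k = (\<lambda>z. \<i> * z * h z)"
  have k: "square_integrable k"
    unfolding k_def using h
    by (intro square_integrable_mult_bounded ess_bounded_continuous) (auto intro!: continuous_intros)
  then have km: "k \<in> borel_measurable circle" by (simp add: square_integrable_def)
  have k_int: "integrable circle k" by (rule integral_norm_le_L2_norm[OF k])
  then have set: "set_integrable lborel {0..2*pi} (\<lambda>s. k (cis s))"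
    by (simp only: integrable_circle_iff[OF km])
  then show "set_integrable lborel {0..2*pi} (\<lambda>s. \<i> * cis s * h (cis s))"
    by (simp only: k_def)
  assume xy: "0 \<le> x" "y \<le> 2*pi"
  have sub: "set_integrable lborel {x..y} (\<lambda>s. k (cis s))"
    by (rule set_integrable_subset[OF set]) (use xy in auto)
  have "norm (integral {x..y} (\<lambda>s. k (cis s))) = norm (LINT s:{x..y}|lborel. k (cis s))"
    using set_borel_integral_eq_integral(2)[OF sub] by simp
  also have "\<dots> \<le> (LINT s:{x..y}|lborel. norm (k (cis s)))"
    by (rule set_integral_norm_bound[OF sub])
  also have "\<dots> \<le> (LINT s:{0..2*pi}|lborel. norm (k (cis s)))"
    unfolding set_lebesgue_integral_def
    by (rule integral_mono)
       (use set_integrable_norm[OF set] set_integrable_norm[OF sub] xy in \<open>auto simp: set_integrable_def split: split_indicator\<close>)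
  also have "\<dots> = 2 * pi * (LINT z|circle. norm (k z))"
    using km by (subst integral_circle) auto
  also have "(LINT z|circle. norm (k z)) = (LINT z|circle. norm (h z))"
    by (rule Bochner_Integration.integral_cong) (auto simp: k_def norm_mult)
  also have "\<dots> \<le> norm (abs_L2 h)" by (rule integral_norm_le_L2_norm[OF h])
  finally show "norm (integral {x..y} (\<lambda>s. \<i> * cis s * h (cis s))) \<le> 2 * pi * norm (abs_L2 h)"
    by (simp add: k_def)
qed

text \<open>The Taylor coefficients at \<open>0\<close> of the primitive of \<open>\<Sum> a\<^sub>n z\<^sup>n\<close> that vanishes there.\<close>
definition primitive_coeff :: "(nat \<Rightarrow> complex) \<Rightarrow> nat \<Rightarrow> complex" where
  "primitive_coeff a n = (case n of 0 \<Rightarrow> 0 | Suc m \<Rightarrow> a m / of_nat (Suc m))"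

lemma diffs_primitive_coeff: "diffs (primitive_coeff a) = a"
  by (rule ext) (simp add: diffs_def primitive_coeff_def del: of_nat_Suc)

text \<open>From \<open>2 x y \<le> x\<^sup>2 + y\<^sup>2\<close> with \<open>x = |a\<^sub>n|\<close> and \<open>y = 1 / (n + 1)\<close>. This is the reason for passing to the primitive: it converges
uniformly on the closed disk.\<close>
lemma summable_primitive_coeff:
  assumes "summable (\<lambda>n. (norm (a n))\<^sup>2)"
  shows "summable (\<lambda>n. norm (primitive_coeff a n))"
proof -
  have "summable (\<lambda>n. norm (a n) / of_nat (Suc n))"
  proof (rule summable_comparison_test')
    show "summable (\<lambda>n. (norm (a n))\<^sup>2 + inverse (of_nat (Suc n)) ^ 2)"
    proof (intro summable_add assms)
      have "summable (\<lambda>n. inverse (real n ^ 2))" by (rule inverse_power_summable) simp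
      then have "summable (\<lambda>n. inverse (real (Suc n) ^ 2))"
        by (rule summable_Suc_iff[where f = "\<lambda>n. inverse (real n ^ 2)", THEN iffD2])
      then show "summable (\<lambda>n. inverse (real (Suc n)) ^ 2)" by (simp only: power_inverse)
    qed
    fix n :: nat
    have "0 \<le> (norm (a n) - inverse (of_nat (Suc n)))\<^sup>2" by simp
    then have "2 * (norm (a n) * inverse (of_nat (Suc n))) \<le> (norm (a n))\<^sup>2 + inverse (of_nat (Suc n)) ^ 2"
      unfolding power2_diff by simp
    moreover have "0 \<le> norm (a n) * inverse (of_nat (Suc n))" by simp
    ultimately show "norm (norm (a n) / of_nat (Suc n)) \<le> (norm (a n))\<^sup>2 + inverse (of_nat (Suc n)) ^ 2"
      by (simp only: divide_inverse real_norm_def abs_of_nonneg)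
  qed
  then have "summable (\<lambda>n. norm (primitive_coeff a (Suc n)))"
    by (simp add: primitive_coeff_def norm_divide del: of_nat_Suc)
  then show ?thesis by (rule summable_Suc_iff[THEN iffD1])
qed

lemma arc_integral_polynomial:
  assumes "x \<le> y"
  shows "((\<lambda>s. \<i> * cis s * (\<Sum>n<N. a n * cis s ^ n)) has_integral
     (\<Sum>n<Suc N. primitive_coeff a n * cis y ^ n) - (\<Sum>n<Suc N. primitive_coeff a n * cis x ^ n)) {x..y}"
proof (rule fundamental_theorem_of_calculus[OF assms])
  fix s :: real
  have "((\<lambda>w. \<Sum>n<N. a n / of_nat (Suc n) * w ^ Suc n) has_field_derivative (\<Sum>n<N. a n * w ^ n)) (at w)" for w
    by (rule DERIV_sum) (auto intro!: derivative_eq_intros simp del: of_nat_Suc power_Suc)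
  moreover have "(\<lambda>w. \<Sum>n<N. a n / of_nat (Suc n) * w ^ Suc n) = (\<lambda>w. \<Sum>n<Suc N. primitive_coeff a n * w ^ n)"
    by (subst sum.lessThan_Suc_shift) (simp add: primitive_coeff_def)
  ultimately have d: "((\<lambda>w. \<Sum>n<Suc N. primitive_coeff a n * w ^ n) has_field_derivative (\<Sum>n<N. a n * w ^ n)) (at w)" for w
    by simp
  have "((\<lambda>s. \<Sum>n<Suc N. primitive_coeff a n * cis s ^ n) has_vector_derivative
      (\<i> * cis s * (\<Sum>n<N. a n * cis s ^ n))) (at s)"
    using field_vector_diff_chain_at[OF cis_has_vector_derivative d] by (simp only: o_def)
  then show "((\<lambda>s. \<Sum>n<Suc N. primitive_coeff a n * cis s ^ n) has_vector_derivative
      (\<i> * cis s * (\<Sum>n<N. a n * cis s ^ n))) (at s within {x..y})"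
    by (rule has_vector_derivative_at_within)
qed

text \<open>Fatou's theorem for \<open>H\<^sup>2\<close>. The identity \<open>G(e\<^sup>i\<^sup>y) - G(e\<^sup>i\<^sup>x) = \<integral> g(z) dz\<close> over the arc from \<open>x\<close> to \<open>y\<close> holds for the
partial sums of the two series and passes to the limit, uniformly on the left-hand side and in \<open>L\<^sup>2\<close> on the right-hand side.\<close>
theorem radial_limit_power_series:
  assumes a: "summable (\<lambda>n. (norm (a n))\<^sup>2)" and g: "square_integrable g"
    and sums: "(\<lambda>n. const_Linf (a n) \<cdot> zpow n) sums abs_L2 g"
  shows "radial_limit (\<lambda>z. \<Sum>n. a n * z ^ n) g"
proof -
  define c where "c = primitive_coeff a"
  have c: "summable (\<lambda>n. norm (c n))" unfolding c_def by (rule summable_primitive_coeff[OF a])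
  define G where "G = (\<lambda>w. \<Sum>n. c n * w ^ n)"
  have le: "norm (c n * w ^ n) \<le> norm (c n)" if "w \<in> cball 0 1" for w n
    using that by (simp add: norm_mult norm_power mult_left_le power_le_one)
  have unif: "uniform_limit (cball 0 1) (\<lambda>N w. \<Sum>n<N. c n * w ^ n) G sequentially"
    unfolding G_def by (rule Weierstrass_m_test[OF le c])
  have contG: "continuous_on (cball 0 1) G"
    by (rule uniform_limit_theorem[OF _ unif]) (auto intro!: always_eventually continuous_intros)
  have derG: "(G has_field_derivative (\<Sum>n. a n * w ^ n)) (at w)" if "w \<in> ball 0 1" for w
  proof -
    have "summable (\<lambda>n. c n * 1 ^ n)" using summable_norm_cancel[OF c] by simp
    then have "(G has_field_derivative (\<Sum>n. diffs c n * w ^ n)) (at w)"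
      unfolding G_def by (rule termdiffs_strong) (use that in simp)
    then show ?thesis by (simp only: c_def diffs_primitive_coeff)
  qed
  have holG: "G holomorphic_on ball 0 1"
    unfolding holomorphic_on_open[OF open_ball] using derG by blast
  have Glim: "(\<lambda>N. \<Sum>n<Suc N. c n * w ^ n) \<longlonglongrightarrow> G w" if "norm w \<le> 1" for w
    using tendsto_uniform_limitI[OF unif, of w] that by (intro LIMSEQ_Suc) auto
  \<comment> \<open>Cutting off outside \<open>[0, 2\<pi>]\<close> makes the integrand integrable on the whole line.\<close>
  define f where "f = (\<lambda>s. indicator {0..2*pi} s *\<^sub>R (\<i> * cis s * g (cis s)))"
  have "integrable lborel f"
    using arc_integrable_bound(1)[OF g] by (simp only: set_integrable_def f_def)
  then have "f integrable_on UNIV" by (rule integrable_on_lborel)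
  then have f_int: "f integrable_on {x..y}" for x y
    using integrable_on_subcbox[of f UNIV x y] by simp
  have f_prim: "integral {x..y} f = G (cis y) - G (cis x)" if "0 \<le> x" "x \<le> y" "y \<le> 2*pi" for x y
  proof (rule LIMSEQ_unique)
    define p where "p = (\<lambda>N z. \<Sum>n<N. a n * z ^ n)"
    have p: "square_integrable (p N)" for N
      unfolding p_def by (intro square_integrable_continuous continuous_intros)
    have f_eq: "f s = \<i> * cis s * g (cis s)" if "s \<in> {x..y}" for s
      using that \<open>0 \<le> x\<close> \<open>y \<le> 2*pi\<close> by (simp add: f_def)
    have "(\<lambda>N. abs_L2 (p N)) \<longlonglongrightarrow> abs_L2 g"
      using sums unfolding sums_def p_def by (simp add: polynomial_L2)
    then have "(\<lambda>N. 2 * pi * norm (abs_L2 (p N) - abs_L2 g)) \<longlonglongrightarrow> 2 * pi * 0"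
      by (intro tendsto_mult tendsto_const tendsto_norm_zero) (rule LIM_zero)
    then have lim: "(\<lambda>N. 2 * pi * norm (abs_L2 (p N) - abs_L2 g)) \<longlonglongrightarrow> 0" by simp
    have bound: "norm (integral {x..y} (\<lambda>s. \<i> * cis s * p N (cis s)) - integral {x..y} f)
        \<le> 2 * pi * norm (abs_L2 (p N) - abs_L2 g)" for N
    proof -
      have "integral {x..y} (\<lambda>s. \<i> * cis s * p N (cis s)) - integral {x..y} f
          = integral {x..y} (\<lambda>s. \<i> * cis s * p N (cis s) - f s)"
        using arc_integral_polynomial[OF \<open>x \<le> y\<close>, where N = N and a = a]
        by (intro integral_diff[symmetric] f_int) (auto simp: p_def integrable_on_def)
      also have "\<dots> = integral {x..y} (\<lambda>s. \<i> * cis s * (p N (cis s) - g (cis s)))"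
        by (rule integral_cong) (simp add: f_eq right_diff_distrib)
      also have "norm \<dots> \<le> 2 * pi * norm (abs_L2 (\<lambda>z. p N z - g z))"
        using that by (intro arc_integrable_bound square_integrable_diff p g)
      finally show ?thesis by (simp only: abs_L2_diff[OF p g])
    qed
    have "(\<lambda>N. integral {x..y} (\<lambda>s. \<i> * cis s * p N (cis s)) - integral {x..y} f) \<longlonglongrightarrow> 0"
      by (rule Lim_null_comparison[OF always_eventually[OF allI[OF bound]] lim])
    then have "(\<lambda>N. integral {x..y} (\<lambda>s. \<i> * cis s * p N (cis s))) \<longlonglongrightarrow> integral {x..y} f"
      by (rule LIM_zero_cancel)
    then show "(\<lambda>N. (\<Sum>n<Suc N. c n * cis y ^ n) - (\<Sum>n<Suc N. c n * cis x ^ n)) \<longlonglongrightarrow> integral {x..y} f"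
      using integral_unique[OF arc_integral_polynomial[OF \<open>x \<le> y\<close>]] by (simp only: p_def c_def)
    show "(\<lambda>N. (\<Sum>n<Suc N. c n * cis y ^ n) - (\<Sum>n<Suc N. c n * cis x ^ n)) \<longlonglongrightarrow> G (cis y) - G (cis x)"
      by (intro tendsto_diff Glim) auto
  qed
  obtain N where N: "negligible N"
    and der: "\<And>t. t \<in> {0<..<2*pi} - N \<Longrightarrow> ((\<lambda>s. G (cis s)) has_vector_derivative f t) (at t)"
    using indefinite_integral_derivative_AE[of f 0 "2*pi" "\<lambda>s. G (cis s)"] f_int f_prim by metis
  have "AE t in lebesgue. t \<notin> N" using N by (intro AE_not_in) (simp add: negligible_iff_null_sets)
  then have "AE t in lborel. t \<notin> N" by (simp only: AE_completion_iff)
  moreover have "AE t in lborel. t \<noteq> 0" "AE t in lborel. t \<noteq> 2*pi" by (rule AE_lborel_singleton)+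
  ultimately have "AE t in lborel. t \<in> {0..2*pi} \<longrightarrow>
      ((\<lambda>r. \<Sum>n. a n * (of_real r * cis t) ^ n) \<longlongrightarrow> g (cis t)) (at_left 1)"
  proof eventually_elim
    case (elim t)
    show ?case
    proof
      assume "t \<in> {0..2*pi}"
      then have t: "t \<in> {0<..<2*pi}" using elim by auto
      then have "f t = \<i> * cis t * g (cis t)" by (simp add: f_def)
      then have "((\<lambda>s. G (cis s)) has_vector_derivative \<i> * cis t * g (cis t)) (at t)"
        using der[of t] t elim by auto
      then have "(G has_field_derivative g (cis t)) (at (cis t) within sphere 0 1)"
        by (rule field_derivative_along_circle[OF t])
      then have "((\<lambda>r. deriv G (of_real r * cis t)) \<longlongrightarrow> g (cis t)) (at_left (1::real))"
        by (intro radial_derivative_limit[OF contG holG]) auto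
      then show "((\<lambda>r. \<Sum>n. a n * (of_real r * cis t) ^ n) \<longlongrightarrow> g (cis t)) (at_left 1)"
      proof (rule Lim_transform_eventually)
        have "\<forall>\<^sub>F r in at_left 1. r \<in> {0<..<1::real}"
          by (rule eventually_at_leftI[of 0]) auto
        then show "\<forall>\<^sub>F r in at_left 1. deriv G (of_real r * cis t) = (\<Sum>n. a n * (of_real r * cis t) ^ n)"
          by eventually_elim (rule DERIV_imp_deriv[OF derG], simp add: norm_mult)
      qed
    qed
  qed
  then show ?thesis unfolding radial_limit_def by (rule AE_circleI)
qed

section \<open>The Hardy space as a space of power series\<close>

lemma integral_circle_const [simp]: "(LINT z|circle. c) = (c::real)"
  by (simp add: measure_def emeasure_circle)

lemma L2_limit_of_uniform_limit:
  assumes p: "\<And>N. continuous_on (sphere 0 1) (p N)"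
    and unif: "uniform_limit (sphere 0 1) p f sequentially"
  shows "continuous_on (sphere 0 1) f" "(\<lambda>N. abs_L2 (p N)) \<longlonglongrightarrow> abs_L2 f"
proof -
  show cf: "continuous_on (sphere 0 1) f"
    by (rule uniform_limit_theorem[OF _ unif]) (use p in auto)
  note sp = square_integrable_continuous[OF p] and sf = square_integrable_continuous[OF cf]
  show "(\<lambda>N. abs_L2 (p N)) \<longlonglongrightarrow> abs_L2 f"
  proof (rule tendstoI)
    fix e :: real assume "e > 0"
    then have "\<forall>\<^sub>F N in sequentially. \<forall>z\<in>sphere 0 1. dist (p N z) (f z) < e / 2"
      by (intro uniform_limitD[OF unif]) simp
    then show "\<forall>\<^sub>F N in sequentially. dist (abs_L2 (p N)) (abs_L2 f) < e"
    proof eventually_elim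
      case (elim N)
      have "(dist (abs_L2 (p N)) (abs_L2 f))\<^sup>2 = (LINT z|circle. (norm (p N z - f z))\<^sup>2)"
        by (simp only: dist_norm abs_L2_diff[OF sp sf] norm_abs_L2[OF square_integrable_diff[OF sp sf]])
      also have "\<dots> \<le> (LINT z|circle. (e / 2)\<^sup>2)"
      proof (rule integral_mono)
        show "integrable circle (\<lambda>z. (norm (p N z - f z))\<^sup>2)"
          using square_integrable_diff[OF sp sf] by (simp add: square_integrable_def)
        fix z assume "z \<in> space circle"
        then have "norm (p N z - f z) \<le> e / 2" using elim by (auto simp: dist_norm less_imp_le)
        then show "(norm (p N z - f z))\<^sup>2 \<le> (e / 2)\<^sup>2" by (intro power_mono) auto
      qed simp
      also have "\<dots> = (e / 2)\<^sup>2" by (rule integral_circle_const)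
      finally have "dist (abs_L2 (p N)) (abs_L2 f) \<le> e / 2"
        by (rule power2_le_imp_le) (use \<open>e > 0\<close> in simp)
      then show ?case using \<open>e > 0\<close> by linarith
    qed
  qed
qed

text \<open>Parseval's identity on the circle of radius \<open>r\<close>, where the power series converges uniformly and therefore in \<open>L\<^sup>2\<close>.\<close>
lemma dilation_L2_limit:
  assumes F: "\<And>z. z \<in> ball 0 1 \<Longrightarrow> (\<lambda>n. a n * z ^ n) sums F z"
    and r: "0 \<le> r" "r < 1"
  shows "square_integrable (\<lambda>z. F (of_real r * z))"
    and "(\<lambda>N. \<Sum>n<N. (norm (a n))\<^sup>2 * r ^ (2*n)) \<longlonglongrightarrow> (LINT z|circle. (norm (F (of_real r * z)))\<^sup>2)"
proof -
  define b where "b = (\<lambda>n. a n * of_real r ^ n)"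
  have "summable (\<lambda>n. norm (b n))"
    unfolding b_def
  proof (rule powser_insidea)
    \<comment> \<open>A point strictly between \<open>r\<close> and \<open>1\<close>: convergence there gives absolute convergence at \<open>r\<close>.\<close>
    show "summable (\<lambda>n. a n * (of_real ((1 + r) / 2)) ^ n)"
      using r by (intro sums_summable[OF F]) (simp add: norm_divide del: of_real_divide of_real_add)
    show "norm (complex_of_real r) < norm (complex_of_real ((1 + r) / 2))"
      using r by (simp only: norm_of_real) simp
  qed
  then have unif: "uniform_limit (sphere 0 1) (\<lambda>N z. \<Sum>n<N. b n * z ^ n) (\<lambda>z. \<Sum>n. b n * z ^ n) sequentially"
    by (intro Weierstrass_m_test) (auto simp: norm_mult norm_power)
  have "(\<Sum>n. b n * z ^ n) = F (of_real r * z)" if "z \<in> sphere 0 1" for z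
    using sums_unique[OF F[of "of_real r * z"]] that r by (simp add: b_def norm_mult power_mult_distrib mult.assoc)
  then have "uniform_limit (sphere 0 1) (\<lambda>N z. \<Sum>n<N. b n * z ^ n) (\<lambda>z. \<Sum>n. b n * z ^ n) sequentially
      \<longleftrightarrow> uniform_limit (sphere 0 1) (\<lambda>N z. \<Sum>n<N. b n * z ^ n) (\<lambda>z. F (of_real r * z)) sequentially"
    by (intro uniform_limit_cong') auto
  with unif have unif': "uniform_limit (sphere 0 1) (\<lambda>N z. \<Sum>n<N. b n * z ^ n) (\<lambda>z. F (of_real r * z)) sequentially"
    by (rule iffD1[rotated])
  have cont: "continuous_on (sphere 0 1) (\<lambda>z. \<Sum>n<N. b n * z ^ n)" for N
    by (intro continuous_intros)
  note lim = L2_limit_of_uniform_limit[OF cont unif']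
  show si: "square_integrable (\<lambda>z. F (of_real r * z))"
    by (rule square_integrable_continuous[OF lim(1)])
  have "(\<lambda>N. (norm (abs_L2 (\<lambda>z. \<Sum>n<N. b n * z ^ n)))\<^sup>2) \<longlonglongrightarrow> (norm (abs_L2 (\<lambda>z. F (of_real r * z))))\<^sup>2"
    by (intro tendsto_intros lim(2))
  moreover have "(norm (abs_L2 (\<lambda>z. \<Sum>n<N. b n * z ^ n)))\<^sup>2 = (\<Sum>n<N. (norm (a n))\<^sup>2 * r ^ (2*n))" for N
  proof -
    have "(norm (b n))\<^sup>2 = (norm (a n))\<^sup>2 * r ^ (2*n)" for n
      using r by (simp add: b_def norm_mult norm_power power_mult_distrib power_mult power2_eq_square mult_ac flip: power_mult_distrib)
    then show ?thesis
      using norm_polynomial[of "{..<N}" b] by (simp add: polynomial_L2)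
  qed
  ultimately show "(\<lambda>N. \<Sum>n<N. (norm (a n))\<^sup>2 * r ^ (2*n)) \<longlonglongrightarrow> (LINT z|circle. (norm (F (of_real r * z)))\<^sup>2)"
    by (simp only: norm_abs_L2[OF si])
qed

text \<open>By Parseval the bound on the integral means dominates every partial sum of \<open>\<Sum> |a\<^sub>n|\<^sup>2 r\<^sup>2\<^sup>n\<close> for all \<open>r < 1\<close>; letting
\<open>r\<close> tend to \<open>1\<close> in a finite sum gives the bound for \<open>r = 1\<close>.\<close>
lemma hardy2_disk_power_series:
  assumes "F \<in> hardy2_disk"
  obtains a where "summable (\<lambda>n. (norm (a n))\<^sup>2)" "\<And>z. z \<in> ball 0 1 \<Longrightarrow> (\<lambda>n. a n * z ^ n) sums F z"
proof
  obtain M where hol: "F holomorphic_on ball 0 1"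
    and M: "\<And>r. r \<in> {0..<1} \<Longrightarrow> (LINT z|circle. (norm (F (of_real r * z)))\<^sup>2) \<le> M"
    using assms unfolding hardy2_disk_def by blast
  define a where "a = (\<lambda>n. (deriv ^^ n) F 0 / fact n)"
  show F: "(\<lambda>n. a n * z ^ n) sums F z" if "z \<in> ball 0 1" for z
    using holomorphic_power_series[OF hol that] by (simp add: a_def)
  show "summable (\<lambda>n. (norm (a n))\<^sup>2)"
  proof (rule bounded_imp_summable)
    fix N
    have "(\<Sum>n\<le>N. (norm (a n))\<^sup>2 * r ^ (2*n)) \<le> M" if r: "r \<in> {0<..<1}" for r
    proof -
      have "(\<Sum>n<Suc N. (norm (a n))\<^sup>2 * r ^ (2*n)) \<le> (LINT z|circle. (norm (F (of_real r * z)))\<^sup>2)"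
      proof (rule incseq_le)
        show "(\<lambda>N. \<Sum>n<N. (norm (a n))\<^sup>2 * r ^ (2*n)) \<longlonglongrightarrow> (LINT z|circle. (norm (F (of_real r * z)))\<^sup>2)"
          by (rule dilation_L2_limit[OF F]) (use r in auto)
        show "incseq (\<lambda>N. \<Sum>n<N. (norm (a n))\<^sup>2 * r ^ (2*n))"
          using r by (intro incseq_SucI) simp
      qed
      also have "\<dots> \<le> M" using M[of r] r by simp
      finally show ?thesis by (simp only: lessThan_Suc_atMost)
    qed
    moreover have "\<forall>\<^sub>F r in at_left 1. r \<in> {0<..<1::real}"
      by (rule eventually_at_leftI[of 0]) auto
    ultimately have "\<forall>\<^sub>F r in at_left 1. (\<Sum>n\<le>N. (norm (a n))\<^sup>2 * r ^ (2*n)) \<le> M"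
      by (auto elim: eventually_mono)
    moreover have "((\<lambda>r. \<Sum>n\<le>N. (norm (a n))\<^sup>2 * r ^ (2*n)) \<longlongrightarrow> (\<Sum>n\<le>N. (norm (a n))\<^sup>2 * 1 ^ (2*n))) (at_left (1::real))"
      by (intro tendsto_intros)
    ultimately have "(\<Sum>n\<le>N. (norm (a n))\<^sup>2 * 1 ^ (2*n)) \<le> M"
      by (intro tendsto_upperbound) auto
    then show "(\<Sum>n\<le>N. (norm (a n))\<^sup>2) \<le> M" by simp
  qed simp
qed

lemma power_series_in_hardy2_disk:
  assumes a: "summable (\<lambda>n. (norm (a n))\<^sup>2)"
  shows "(\<lambda>z. \<Sum>n. a n * z ^ n) \<in> hardy2_disk"
proof -
  have F: "(\<lambda>n. a n * z ^ n) sums (\<Sum>n. a n * z ^ n)" if z: "z \<in> ball 0 1" for z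
  proof (rule summable_sums, rule summable_norm_cancel, rule summable_comparison_test')
    have "(norm z)\<^sup>2 < 1" using z by (simp add: power_less_one_iff abs_square_less_1)
    then show "summable (\<lambda>n. (norm (a n))\<^sup>2 + ((norm z)\<^sup>2) ^ n)"
      by (intro summable_add a summable_geometric) simp
    fix n :: nat
    have "0 \<le> (norm (a n) - norm z ^ n)\<^sup>2" by simp
    then have "2 * (norm (a n) * norm z ^ n) \<le> (norm (a n))\<^sup>2 + (norm z ^ n)\<^sup>2"
      unfolding power2_diff by simp
    moreover have "0 \<le> norm (a n) * norm z ^ n" by simp
    moreover have "(norm z ^ n)\<^sup>2 = ((norm z)\<^sup>2) ^ n" by (simp only: power_mult[symmetric] mult.commute)
    ultimately have "norm (a n) * norm z ^ n \<le> (norm (a n))\<^sup>2 + ((norm z)\<^sup>2) ^ n"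
      by linarith
    then show "norm (norm (a n * z ^ n)) \<le> (norm (a n))\<^sup>2 + ((norm z)\<^sup>2) ^ n"
      by (simp add: norm_mult norm_power)
  qed
  have "(\<lambda>z. \<Sum>n. a n * z ^ n) holomorphic_on ball 0 1"
    using F by (intro power_series_holomorphic[of 0 1 a]) simp
  moreover have "(LINT z|circle. (norm (\<Sum>n. a n * (of_real r * z) ^ n))\<^sup>2) \<le> (\<Sum>n. (norm (a n))\<^sup>2)"
    if r: "r \<in> {0..<1}" for r :: real
  proof (rule LIMSEQ_le_const2)
    show "(\<lambda>N. \<Sum>n<N. (norm (a n))\<^sup>2 * r ^ (2*n)) \<longlonglongrightarrow> (LINT z|circle. (norm (\<Sum>n. a n * (of_real r * z) ^ n))\<^sup>2)"
      by (rule dilation_L2_limit(2)[where F = "\<lambda>z. \<Sum>n. a n * z ^ n", OF F]) (use r in auto)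
    have "(\<Sum>n<N. (norm (a n))\<^sup>2 * r ^ (2*n)) \<le> (\<Sum>n. (norm (a n))\<^sup>2)" for N
    proof -
      have "(\<Sum>n<N. (norm (a n))\<^sup>2 * r ^ (2*n)) \<le> (\<Sum>n<N. (norm (a n))\<^sup>2)"
        using r by (intro sum_mono mult_left_le power_le_one) auto
      also have "\<dots> \<le> (\<Sum>n. (norm (a n))\<^sup>2)" by (intro sum_le_suminf a) auto
      finally show ?thesis .
    qed
    then show "\<exists>N0. \<forall>N\<ge>N0. (\<Sum>n<N. (norm (a n))\<^sup>2 * r ^ (2*n)) \<le> (\<Sum>n. (norm (a n))\<^sup>2)" by blast
  qed
  ultimately show ?thesis unfolding hardy2_disk_def by blast
qed

lemma radial_limit_unique:
  assumes "radial_limit F f" "radial_limit G g" and "\<And>z. z \<in> ball 0 1 \<Longrightarrow> F z = G z"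
  shows "AE z in circle. f z = g z"
proof -
  have "AE z in circle. z \<in> space circle" by (rule AE_space)
  then show ?thesis
    using assms(1,2) unfolding radial_limit_def
  proof eventually_elim
    case (elim z)
    have "\<forall>\<^sub>F r in at_left 1. r \<in> {0<..<1::real}"
      by (rule eventually_at_leftI[of 0]) auto
    then have "\<forall>\<^sub>F r in at_left 1. F (of_real r * z) = G (of_real r * z)"
      by eventually_elim (rule assms(3), use elim in \<open>simp add: norm_mult\<close>)
    then have "((\<lambda>r. G (of_real r * z)) \<longlongrightarrow> f z) (at_left 1)"
      by (rule Lim_transform_eventually[OF elim(2)])
    then show ?case using elim(3) by (rule tendsto_unique[rotated]) simp
  qed
qed

text \<open>For the inclusion of \<open>H\<^sup>2\<close>, the Taylor series of \<open>F\<close> also has an \<open>L\<^sup>2\<close> sum \<open>k\<close>. By Fatou's theorem \<open>k\<close> is a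
radial limit of \<open>F\<close>, and radial limits are unique, so \<open>k\<close> is the given boundary function.\<close>
lemma H2_eq_power_series:
  "f \<in> H2 \<longleftrightarrow> (\<exists>a. summable (\<lambda>n. (norm (a n))\<^sup>2) \<and> (\<lambda>n. const_Linf (a n) \<cdot> zpow n) sums f)"
proof
  obtain f' where f': "square_integrable f'" "f = abs_L2 f'" by (rule L2_cases)
  have bd: "boundary_L2 F f \<longleftrightarrow> radial_limit F f'" for F
    using f' by (simp add: boundary_L2.abs_eq)
  {
    assume "\<exists>a. summable (\<lambda>n. (norm (a n))\<^sup>2) \<and> (\<lambda>n. const_Linf (a n) \<cdot> zpow n) sums f"
    then obtain a where a: "summable (\<lambda>n. (norm (a n))\<^sup>2)" "(\<lambda>n. const_Linf (a n) \<cdot> zpow n) sums abs_L2 f'"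
      using f' by blast
    have "radial_limit (\<lambda>z. \<Sum>n. a n * z ^ n) f'" by (rule radial_limit_power_series[OF a(1) f'(1) a(2)])
    then show "f \<in> H2"
      using power_series_in_hardy2_disk[OF a(1)] bd unfolding H2_def by blast
  next
    assume "f \<in> H2"
    then obtain F where F: "F \<in> hardy2_disk" "radial_limit F f'" using bd by (auto simp: H2_def)
    obtain a where a: "summable (\<lambda>n. (norm (a n))\<^sup>2)" "\<And>z. z \<in> ball 0 1 \<Longrightarrow> (\<lambda>n. a n * z ^ n) sums F z"
      using hardy2_disk_power_series[OF F(1)] by metis
    obtain k where k: "(\<lambda>n. const_Linf (a n) \<cdot> zpow n) sums k"
      using L2_power_series_summable[OF a(1)] by (auto simp: summable_def)
    obtain k' where k': "square_integrable k'" "k = abs_L2 k'" by (rule L2_cases)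
    have "AE z in circle. f' z = k' z"
    proof (rule radial_limit_unique[OF F(2)])
      show "radial_limit (\<lambda>z. \<Sum>n. a n * z ^ n) k'"
        using radial_limit_power_series[OF a(1) k'(1)] k k' by simp
      show "F z = (\<Sum>n. a n * z ^ n)" if "z \<in> ball 0 1" for z
        by (rule sums_unique[OF a(2)[OF that]])
    qed
    then have "f = k" using f' k' by (simp add: abs_L2_eq_iff)
    then show "\<exists>a. summable (\<lambda>n. (norm (a n))\<^sup>2) \<and> (\<lambda>n. const_Linf (a n) \<cdot> zpow n) sums f"
      using a k by blast
  }
qed

text \<open>With the coefficients determined by \<open>f\<close>, the condition becomes visibly linear in \<open>f\<close>.\<close>
lemma H2_iff_fourier_series:
  "f \<in> H2 \<longleftrightarrow> (\<lambda>n. const_Linf (cinner f (zpow n)) \<cdot> zpow n) sums f"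
proof
  assume "f \<in> H2"
  then obtain a where a: "(\<lambda>n. const_Linf (a n) \<cdot> zpow n) sums f" by (auto simp: H2_eq_power_series)
  then have "(\<lambda>n. cinner f (zpow n)) = a" by (intro ext) (rule cinner_power_series_zpow)
  then show "(\<lambda>n. const_Linf (cinner f (zpow n)) \<cdot> zpow n) sums f" using a by (simp add: fun_eq_iff)
qed (use bessel_summable[of f] in \<open>auto simp: H2_eq_power_series\<close>)

lemma const_Linf_add: "const_Linf (c + d) = const_Linf c + const_Linf d"
  by transfer (auto simp: ess_bounded_const)

lemma H2_add: "f \<in> H2 \<Longrightarrow> g \<in> H2 \<Longrightarrow> f + g \<in> H2"
  by (auto simp: H2_iff_fourier_series cinner_add_left const_Linf_add mult_op_add_left intro: sums_add)

lemma H2_const_mult: "f \<in> H2 \<Longrightarrow> const_Linf c \<cdot> f \<in> H2"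
  using bounded_linear.sums[OF mult_op_bounded_linear, of _ f "const_Linf c"]
  by (auto simp: H2_iff_fourier_series cinner_const const_Linf_mult mult_op_mult)

lemma H2_uminus: "f \<in> H2 \<Longrightarrow> - f \<in> H2"
proof -
  have "const_Linf (- 1) \<cdot> f = - f" for f
    by transfer (auto simp: square_integrable_uminus)
  then show "f \<in> H2 \<Longrightarrow> - f \<in> H2" using H2_const_mult[of f "-1"] by simp
qed

lemma H2_diff: "f \<in> H2 \<Longrightarrow> g \<in> H2 \<Longrightarrow> f - g \<in> H2"
  using H2_add[OF _ H2_uminus, of f g] by simp

text \<open>The projection is the nonnegative half of the Fourier series: it exists in \<open>L\<^sup>2\<close> by Bessel and
completeness, and the remainder is orthogonal to every power \<open>z\<^sup>n\<close>, whose series exhaust \<open>H\<^sup>2\<close>.\<close>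
lemma H2_projection_exists: "\<exists>g\<in>H2. f - g \<in> orth_compl H2"
proof -
  let ?a = "\<lambda>n. cinner f (zpow n)"
  obtain g where g: "(\<lambda>n. const_Linf (?a n) \<cdot> zpow n) sums g"
    using L2_power_series_summable[OF bessel_summable] by (auto simp: summable_def)
  then have "g \<in> H2" using bessel_summable[of f] unfolding H2_eq_power_series by (intro exI[of _ ?a]) simp
  moreover have "cinner (f - g) h = 0" if "h \<in> H2" for h
  proof -
    have z: "cinner (zpow n) (f - g) = 0" for n
      by (subst cinner_commute) (simp add: cinner_diff_left cinner_power_series_zpow[OF g])
    have "(\<lambda>n. cinner (const_Linf (cinner h (zpow n)) \<cdot> zpow n) (f - g)) sums cinner h (f - g)"
      using that by (intro bounded_linear.sums[OF bounded_linear_cinner_left]) (simp add: H2_iff_fourier_series)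
    then have "cinner h (f - g) = 0" by (simp add: cinner_const z sums_iff)
    then show ?thesis by (subst cinner_commute) simp
  qed
  ultimately show ?thesis by (auto simp: orth_compl_def)
qed

text \<open>Radial limits multiply, and a bounded factor preserves the bound on the integral means.\<close>
lemma inner_function_mult_H2:
  assumes "inner_function \<theta>" "f \<in> H2"
  shows "\<theta> \<cdot> f \<in> H2"
proof -
  obtain T where T: "T holomorphic_on ball 0 1" "bounded (T ` ball 0 1)" "boundary_Linf T \<theta>"
    using assms(1) by (auto simp: inner_function_def)
  obtain F where F: "F \<in> hardy2_disk" "boundary_L2 F f" using assms(2) by (auto simp: H2_def)
  obtain t where t: "ess_bounded t" "\<theta> = abs_Linf t" by (rule Linf_cases)
  obtain f' where f': "square_integrable f'" "f = abs_L2 f'" by (rule L2_cases)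
  have "radial_limit T t" "radial_limit F f'"
    using T(3) F(2) t f' by (simp_all add: boundary_Linf.abs_eq boundary_L2.abs_eq)
  then have "radial_limit (\<lambda>z. T z * F z) (\<lambda>z. t z * f' z)"
    unfolding radial_limit_def by eventually_elim (rule tendsto_mult)
  then have "boundary_L2 (\<lambda>z. T z * F z) (\<theta> \<cdot> f)"
    using square_integrable_mult_bounded[OF t(1) f'(1)]
    by (simp add: t(2) f'(2) mult_op_abs[OF t(1) f'(1)] boundary_L2.abs_eq)
  moreover have "(\<lambda>z. T z * F z) \<in> hardy2_disk"
  proof -
    obtain C where C: "\<forall>z\<in>ball 0 1. norm (T z) \<le> C"
      using T(2) unfolding bounded_iff by blast
    obtain M where hol: "F holomorphic_on ball 0 1"
      and M: "\<And>r. r \<in> {0..<1} \<Longrightarrow> (LINT z|circle. (norm (F (of_real r * z)))\<^sup>2) \<le> M"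
      using F(1) unfolding hardy2_disk_def by blast
    have "(LINT z|circle. (norm (T (of_real r * z) * F (of_real r * z)))\<^sup>2) \<le> C\<^sup>2 * M" if r: "r \<in> {0..<1}" for r :: real
    proof -
      have ball: "of_real r * z \<in> ball 0 1" if "z \<in> sphere 0 1" for z :: complex
        using r that by (simp add: norm_mult)
      have cont: "square_integrable (\<lambda>z. H (of_real r * z))" if "H holomorphic_on ball 0 1" for H
        using ball by (intro square_integrable_continuous continuous_on_compose2[OF holomorphic_on_imp_continuous_on[OF that]])
          (auto intro!: continuous_intros)
      have "(LINT z|circle. (norm (T (of_real r * z) * F (of_real r * z)))\<^sup>2) \<le> (LINT z|circle. C\<^sup>2 * (norm (F (of_real r * z)))\<^sup>2)"
      proof (rule integral_mono)
        show "integrable circle (\<lambda>z. (norm (T (of_real r * z) * F (of_real r * z)))\<^sup>2)"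
          using cont[OF holomorphic_on_mult[OF T(1) hol]] by (simp add: square_integrable_def)
        show "integrable circle (\<lambda>z. C\<^sup>2 * (norm (F (of_real r * z)))\<^sup>2)"
          using cont[OF hol] by (simp add: square_integrable_def)
        fix z assume "z \<in> space circle"
        then have "norm (T (of_real r * z)) \<le> C" using C ball by auto
        then show "(norm (T (of_real r * z) * F (of_real r * z)))\<^sup>2 \<le> C\<^sup>2 * (norm (F (of_real r * z)))\<^sup>2"
          by (simp add: norm_mult power_mult_distrib mult_right_mono power_mono)
      qed
      also have "\<dots> = C\<^sup>2 * (LINT z|circle. (norm (F (of_real r * z)))\<^sup>2)" by simp
      also have "\<dots> \<le> C\<^sup>2 * M" using M[OF r] by (simp add: mult_left_mono)
      finally show ?thesis .
    qed
    then show ?thesis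
      using holomorphic_on_mult[OF T(1) hol] unfolding hardy2_disk_def by blast
  qed
  ultimately show ?thesis unfolding H2_def by blast
qed

section \<open>Orthogonal projections and model spaces\<close>

lemma orth_compl_add: "f \<in> orth_compl S \<Longrightarrow> g \<in> orth_compl S \<Longrightarrow> f + g \<in> orth_compl S"
  by (simp add: orth_compl_def cinner_add_left)

lemma orth_compl_diff: "f \<in> orth_compl S \<Longrightarrow> g \<in> orth_compl S \<Longrightarrow> f - g \<in> orth_compl S"
  by (simp add: orth_compl_def cinner_diff_left)

lemma orth_compl_const_mult: "f \<in> orth_compl S \<Longrightarrow> const_Linf c \<cdot> f \<in> orth_compl S"
  by (simp add: orth_compl_def cinner_const)

lemma in_orth_compl_self: "f \<in> S \<Longrightarrow> f \<in> orth_compl S \<Longrightarrow> f = 0"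
  using cinner_self_eq_0_iff[of f] by (simp add: orth_compl_def)

lemma in_orth_compl_orth_compl: "f \<in> S \<Longrightarrow> f \<in> orth_compl (orth_compl S)"
  using cinner_commute[of f] by (simp add: orth_compl_def)

lemma orth_proj_eqI:
  assumes diff: "\<And>g h. g \<in> S \<Longrightarrow> h \<in> S \<Longrightarrow> g - h \<in> S"
    and g: "g \<in> S" "f - g \<in> orth_compl S"
  shows "orth_proj S f = g"
  unfolding orth_proj_def
proof (rule the_equality)
  show "g \<in> S \<and> f - g \<in> orth_compl S" using g by simp
  fix h assume h: "h \<in> S \<and> f - h \<in> orth_compl S"
  have "h - g \<in> S" using h g diff by blast
  moreover have "h - g \<in> orth_compl S"
    using orth_compl_diff[OF g(2), of "f - h"] h by simp
  ultimately have "h - g = 0" by (rule in_orth_compl_self)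
  then show "h = g" by simp
qed

lemma P_plus_eqI: "g \<in> H2 \<Longrightarrow> f - g \<in> H2_minus \<Longrightarrow> P_plus f = g"
  unfolding P_plus_def H2_minus_def by (rule orth_proj_eqI) (auto intro: H2_diff)

lemma P_plus_in_H2: "P_plus f \<in> H2" and P_minus_in_H2_minus: "P_minus f \<in> H2_minus"
proof -
  obtain g where g: "g \<in> H2" "f - g \<in> H2_minus"
    using H2_projection_exists[of f] unfolding H2_minus_def by blast
  then have "P_plus f = g" by (rule P_plus_eqI)
  then show "P_plus f \<in> H2" "P_minus f \<in> H2_minus" using g by (simp_all add: P_minus_def)
qed

lemma P_plus_P_minus: "P_plus f + P_minus f = f" "P_minus f + P_plus f = f"
  by (simp_all add: P_minus_def)

lemma P_sum:
  assumes "g \<in> H2" "h \<in> H2_minus"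
  shows "P_plus (h + g) = g" "P_minus (h + g) = h"
proof -
  show "P_plus (h + g) = g" by (rule P_plus_eqI) (use assms in simp_all)
  then show "P_minus (h + g) = h" by (simp add: P_minus_def)
qed

lemma P_plus_add: "P_plus (f + g) = P_plus f + P_plus g"
proof (rule P_plus_eqI)
  show "P_plus f + P_plus g \<in> H2" by (intro H2_add P_plus_in_H2)
  have "f + g - (P_plus f + P_plus g) = P_minus f + P_minus g" by (simp add: P_minus_def)
  then show "f + g - (P_plus f + P_plus g) \<in> H2_minus"
    using orth_compl_add P_minus_in_H2_minus unfolding H2_minus_def by metis
qed

lemma P_plus_const_mult: "P_plus (const_Linf c \<cdot> f) = const_Linf c \<cdot> P_plus f"
proof (rule P_plus_eqI)
  show "const_Linf c \<cdot> P_plus f \<in> H2" by (intro H2_const_mult P_plus_in_H2)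
  have "const_Linf c \<cdot> f - const_Linf c \<cdot> P_plus f = const_Linf c \<cdot> P_minus f"
    by (simp add: P_minus_def mult_op_diff)
  then show "const_Linf c \<cdot> f - const_Linf c \<cdot> P_plus f \<in> H2_minus"
    using orth_compl_const_mult P_minus_in_H2_minus unfolding H2_minus_def by metis
qed

lemma scaleR_eq_const_mult: "r *\<^sub>R f = const_Linf (of_real r) \<cdot> f"
  by transfer (auto intro: square_integrable_scale)

lemma P_plus_bounded_linear: "bounded_linear P_plus"
proof (rule bounded_linear_intro[where K = 1])
  show "P_plus (f + g) = P_plus f + P_plus g" for f g by (rule P_plus_add)
  show "P_plus (r *\<^sub>R f) = r *\<^sub>R P_plus f" for r f
    unfolding scaleR_eq_const_mult by (rule P_plus_const_mult)
  fix f
  have "cinner (P_minus f) (P_plus f) = 0"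
    using P_minus_in_H2_minus[of f] P_plus_in_H2[of f] by (simp add: H2_minus_def orth_compl_def)
  from pythagoras[OF this] have "(norm (P_plus f))\<^sup>2 \<le> (norm f)\<^sup>2"
    by (simp add: P_plus_P_minus)
  then have "norm (P_plus f) \<le> norm f" by (rule power2_le_imp_le) simp
  then show "norm (P_plus f) \<le> norm f * 1" by simp
qed

lemma P_minus_bounded_linear: "bounded_linear P_minus"
  unfolding P_minus_def[abs_def] by (intro bounded_linear_sub bounded_linear_ident P_plus_bounded_linear)

text \<open>Orthogonality of \<open>k\<close> to \<open>\<theta> H\<^sup>2\<close> is orthogonality of \<open>\<theta>\<^sup>* k\<close> to \<open>H\<^sup>2\<close>.\<close>
lemma K_space_iff: "k \<in> K_space \<theta> \<longleftrightarrow> k \<in> H2 \<and> conj_Linf \<theta> \<cdot> k \<in> H2_minus"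
  by (simp add: K_space_def H2_minus_def orth_compl_def cinner_mult_op)

lemma K_perp_sum:
  assumes "fm \<in> H2_minus" "fp \<in> H2"
  shows "fm + \<theta> \<cdot> fp \<in> K_perp \<theta>"
proof -
  have "cinner (fm + \<theta> \<cdot> fp) k = 0" if "k \<in> K_space \<theta>" for k
  proof -
    have "cinner fm k = 0"
      using that assms(1) by (simp add: K_space_def H2_minus_def orth_compl_def)
    moreover have "cinner (\<theta> \<cdot> fp) k = 0"
      using that assms(2) cinner_commute[of "\<theta> \<cdot> fp" k] by (simp add: K_space_def orth_compl_def)
    ultimately show ?thesis by (simp add: cinner_add_left)
  qed
  then show ?thesis by (simp add: K_perp_def orth_compl_def)
qed

lemma inner_function_cancel:
  assumes "inner_function \<theta>"
  shows "conj_Linf \<theta> \<cdot> (\<theta> \<cdot> f) = f"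
  using unimodular_conj_mult[of \<theta>] assms by (simp add: inner_function_def flip: mult_op_mult)

text \<open>The difference is \<open>P\<^sup>+ f - \<theta> p\<close> with \<open>p = P\<^sup>+ (\<theta>\<^sup>* P\<^sup>+ f)\<close>. It lies in \<open>H\<^sup>2\<close>, and as \<open>\<theta>\<^sup>* \<theta> = 1\<close>, multiplication by
\<open>\<theta>\<^sup>*\<close> turns it into \<open>P\<^sup>- (\<theta>\<^sup>* P\<^sup>+ f)\<close>.\<close>
lemma K_space_decomposition:
  assumes "inner_function \<theta>"
  shows "f - (P_minus f + \<theta> \<cdot> P_plus (conj_Linf \<theta> \<cdot> P_plus f)) \<in> K_space \<theta>"
proof -
  define p where "p = P_plus (conj_Linf \<theta> \<cdot> P_plus f)"
  have "p \<in> H2" unfolding p_def by (rule P_plus_in_H2)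
  have eq: "f - (P_minus f + \<theta> \<cdot> p) = P_plus f - \<theta> \<cdot> p" by (simp add: P_minus_def)
  have "P_plus f - \<theta> \<cdot> p \<in> H2"
    by (intro H2_diff P_plus_in_H2 inner_function_mult_H2[OF assms] \<open>p \<in> H2\<close>)
  moreover have "conj_Linf \<theta> \<cdot> (P_plus f - \<theta> \<cdot> p) = P_minus (conj_Linf \<theta> \<cdot> P_plus f)"
    by (simp add: mult_op_diff inner_function_cancel[OF assms] P_minus_def p_def)
  ultimately show ?thesis
    unfolding K_space_iff p_def[symmetric] eq by (simp add: P_minus_in_H2_minus)
qed

text \<open>The two sides differ by an element of \<open>K\<^sub>\<theta>\<close> that is also orthogonal to \<open>K\<^sub>\<theta>\<close>.\<close>
lemma K_perp_eq:
  assumes "inner_function \<theta>" "f \<in> K_perp \<theta>"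
  shows "f = P_minus f + \<theta> \<cdot> P_plus (conj_Linf \<theta> \<cdot> P_plus f)"
proof -
  let ?g = "P_minus f + \<theta> \<cdot> P_plus (conj_Linf \<theta> \<cdot> P_plus f)"
  have "f - ?g \<in> K_space \<theta>" by (rule K_space_decomposition[OF assms(1)])
  moreover have "f - ?g \<in> orth_compl (K_space \<theta>)"
    using assms(2) K_perp_sum[OF P_minus_in_H2_minus P_plus_in_H2] unfolding K_perp_def
    by (rule orth_compl_diff)
  ultimately have "f - ?g = 0" by (rule in_orth_compl_self)
  then show ?thesis by simp
qed

text \<open>Splitting off the component of \<open>f\<close> in \<open>K\<^sub>\<alpha>\<close> leaves \<open>Q\<^sub>\<alpha> f\<close>, so \<open>Q\<^sub>\<alpha> f = 0\<close> means that \<open>f\<close> is its own component.\<close>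
lemma Q_proj_eq_0_iff:
  assumes "inner_function \<alpha>"
  shows "Q_proj \<alpha> f = 0 \<longleftrightarrow> f \<in> K_space \<alpha>"
proof -
  let ?g = "P_minus f + \<alpha> \<cdot> P_plus (conj_Linf \<alpha> \<cdot> P_plus f)"
  have proj: "Q_proj \<alpha> f = g" if "g \<in> K_perp \<alpha>" "f - g \<in> K_space \<alpha>" for g
    unfolding Q_proj_def
  proof (rule orth_proj_eqI)
    show "f - g \<in> orth_compl (K_perp \<alpha>)"
      unfolding K_perp_def by (rule in_orth_compl_orth_compl[OF that(2)])
  qed (use that in \<open>auto simp: K_perp_def intro: orth_compl_diff\<close>)
  have k: "f - ?g \<in> K_space \<alpha>" by (rule K_space_decomposition[OF assms])
  show ?thesis
  proof
    assume "Q_proj \<alpha> f = 0"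
    then have "?g = 0" using proj[OF K_perp_sum[OF P_minus_in_H2_minus P_plus_in_H2] k] by simp
    then show "f \<in> K_space \<alpha>" using k by (simp only: diff_zero)
  next
    assume "f \<in> K_space \<alpha>"
    then show "Q_proj \<alpha> f = 0" by (intro proj) (simp_all add: K_perp_def orth_compl_def)
  qed
qed

text \<open>As \<open>\<theta> f\<^sub>+\<close> lies in \<open>H\<^sup>2\<close>, the sum \<open>f\<^sub>- + \<theta> f\<^sub>+\<close> is already split along \<open>H\<^sup>2\<^sub>-\<close> and \<open>H\<^sup>2\<close>. Hence both parts
depend linearly and continuously on it.\<close>
lemma decomposition_parts:
  assumes \<theta>: "inner_function \<theta>" and "fm \<in> H2_minus" "fp \<in> H2"
  shows "P_minus (fm + \<theta> \<cdot> fp) = fm" "conj_Linf \<theta> \<cdot> P_plus (fm + \<theta> \<cdot> fp) = fp"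
  using P_sum[OF inner_function_mult_H2[OF \<theta> assms(3)] assms(2)]
  by (simp_all add: inner_function_cancel[OF \<theta>])

text \<open>In this form \<open>f\<^sub>+ = \<theta>\<^sup>* P\<^sup>+ f\<close> is given by a bounded operator, which makes the continuity of \<open>N\<close> evident.\<close>
lemma K_perp_decomposition:
  assumes \<theta>: "inner_function \<theta>" and f: "f \<in> K_perp \<theta>"
  shows "conj_Linf \<theta> \<cdot> P_plus f \<in> H2" "f = P_minus f + \<theta> \<cdot> (conj_Linf \<theta> \<cdot> P_plus f)"
proof -
  note eq = K_perp_eq[OF \<theta> f]
  have "conj_Linf \<theta> \<cdot> P_plus f = P_plus (conj_Linf \<theta> \<cdot> P_plus f)"
    using decomposition_parts(2)[OF \<theta> P_minus_in_H2_minus P_plus_in_H2, of f "conj_Linf \<theta> \<cdot> P_plus f"]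
    by (simp only: eq[symmetric])
  then show "conj_Linf \<theta> \<cdot> P_plus f \<in> H2" "f = P_minus f + \<theta> \<cdot> (conj_Linf \<theta> \<cdot> P_plus f)"
    using P_plus_in_H2 eq by metis+
qed

section \<open>The two kernels\<close>

lemma ker_D_iff:
  assumes "inner_function \<alpha>"
  shows "f \<in> ker_D \<phi> \<theta> \<alpha> \<longleftrightarrow> f \<in> K_perp \<theta> \<and> \<phi> \<cdot> f \<in> H2 \<and> conj_Linf \<alpha> \<cdot> (\<phi> \<cdot> f) \<in> H2_minus"
  by (simp add: ker_D_def D_op_def Q_proj_eq_0_iff[OF assms] K_space_iff)

lemma ker_paired_op_iff:
  assumes "A = vector [vector [\<phi> * \<theta>, - 1], vector [\<phi> * \<theta> * conj_Linf \<alpha>, 0]]"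
    and "B = vector [vector [\<phi>, 0], vector [conj_Linf \<alpha> * \<phi>, - 1]]"
  shows "u \<in> ker_op (paired_op A B) \<longleftrightarrow>
     (let f = P_minus (u $ 1) + \<theta> \<cdot> P_plus (u $ 1)
      in P_plus (u $ 2) = \<phi> \<cdot> f \<and> P_minus (u $ 2) = conj_Linf \<alpha> \<cdot> (\<phi> \<cdot> f))"
proof -
  define f where "f = P_minus (u $ 1) + \<theta> \<cdot> P_plus (u $ 1)"
  have "paired_op A B u $ 1 = \<phi> \<cdot> f - P_plus (u $ 2)"
    by (simp add: paired_op_def matrix_op_def assms sum_2 vector_2 f_def mult_op_mult mult_op_add mult_op_uminus_left)
  moreover have "paired_op A B u $ 2 = conj_Linf \<alpha> \<cdot> (\<phi> \<cdot> f) - P_minus (u $ 2)"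
    by (simp add: paired_op_def matrix_op_def assms sum_2 vector_2 f_def mult_op_mult mult_op_add mult_op_uminus_left
          mult.commute[of _ "conj_Linf \<alpha>"])
  ultimately show ?thesis
    by (auto simp: ker_op_def vec_eq_iff forall_2 f_def[symmetric] Let_def)
qed

theorem theorem6p1:
  fixes \<phi> \<alpha> \<theta> :: Linf and A B :: "Linf^2^2"
  assumes "inner_function \<alpha>" and "inner_function \<theta>"
    and "A = vector [vector [\<phi> * \<theta>, - 1], vector [\<phi> * \<theta> * conj_Linf \<alpha>, 0]]"
    and "B = vector [vector [\<phi>, 0], vector [conj_Linf \<alpha> * \<phi>, - 1]]"
  shows "(\<forall>f\<in>ker_D \<phi> \<theta> \<alpha>. \<exists>!(fm, fp). fm \<in> H2_minus \<and> fp \<in> H2 \<and> f = fm + \<theta> \<cdot> fp) \<and>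
    (\<exists>N. (\<forall>fm\<in>H2_minus. \<forall>fp\<in>H2. fm + \<theta> \<cdot> fp \<in> ker_D \<phi> \<theta> \<alpha> \<longrightarrow>
            N (fm + \<theta> \<cdot> fp) = vector [fm + fp, (\<phi> * (1 + conj_Linf \<alpha>)) \<cdot> (fm + \<theta> \<cdot> fp)]) \<and>
         isomorphism_on (ker_D \<phi> \<theta> \<alpha>) (ker_op (paired_op A B)) N) \<and>
    ker_D \<phi> \<theta> \<alpha> = (\<lambda>x. P_minus x + \<theta> \<cdot> P_plus x) ` (\<lambda>u. u $ 1) ` ker_op (paired_op A B)"
proof -
  note \<alpha> = assms(1) and \<theta> = assms(2)
  let ?V = "ker_D \<phi> \<theta> \<alpha>" and ?W = "ker_op (paired_op A B)"
  \<comment> \<open>\<open>U\<close> is the first component \<open>f\<^sub>- + \<theta> f\<^sub>+ \<mapsto> f\<^sub>- + f\<^sub>+\<close> of \<open>N\<close>, and \<open>S\<close> is its inverse.\<close>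
  define U where "U = (\<lambda>f. P_minus f + conj_Linf \<theta> \<cdot> P_plus f)"
  define S where "S = (\<lambda>x. P_minus x + \<theta> \<cdot> P_plus x)"
  define N :: "L2 \<Rightarrow> L2^2" where "N = (\<lambda>f. vector [U f, (\<phi> * (1 + conj_Linf \<alpha>)) \<cdot> f])"
  define N' :: "L2^2 \<Rightarrow> L2" where "N' = (\<lambda>u. S (u $ 1))"
  \<comment> \<open>For \<open>f\<close> in the kernel this is the splitting of the second component of \<open>N f\<close> along \<open>H\<^sup>2\<^sub>-\<close> and \<open>H\<^sup>2\<close>.\<close>
  have second: "(\<phi> * (1 + conj_Linf \<alpha>)) \<cdot> f = conj_Linf \<alpha> \<cdot> (\<phi> \<cdot> f) + \<phi> \<cdot> f" for f
    by (simp add: distrib_left mult_op_add_left mult.commute[of \<phi>] flip: mult_op_mult)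
  have ker_W: "u \<in> ?W \<longleftrightarrow> P_plus (u $ 2) = \<phi> \<cdot> N' u \<and> P_minus (u $ 2) = conj_Linf \<alpha> \<cdot> (\<phi> \<cdot> N' u)" for u
    using ker_paired_op_iff[OF assms(3,4), of u] by (simp add: N'_def S_def Let_def)
  have V_decomp: "conj_Linf \<theta> \<cdot> P_plus f \<in> H2" "f = P_minus f + \<theta> \<cdot> (conj_Linf \<theta> \<cdot> P_plus f)" if "f \<in> ?V" for f
    using K_perp_decomposition[OF \<theta>, of f] that by (simp_all add: ker_D_iff[OF \<alpha>])
  have SU: "S (U f) = f" if "f \<in> ?V" for f
  proof -
    have "P_plus (U f) = conj_Linf \<theta> \<cdot> P_plus f" "P_minus (U f) = P_minus f"
      unfolding U_def by (rule P_sum[OF V_decomp(1)[OF that] P_minus_in_H2_minus])+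
    then show ?thesis using V_decomp(2)[OF that] by (simp add: S_def)
  qed
  have N'N: "N' (N f) = f" if "f \<in> ?V" for f
    using SU[OF that] by (simp add: N_def N'_def)
  have N_in: "N f \<in> ?W" if "f \<in> ?V" for f
  proof -
    have f: "\<phi> \<cdot> f \<in> H2" "conj_Linf \<alpha> \<cdot> (\<phi> \<cdot> f) \<in> H2_minus"
      using that by (simp_all add: ker_D_iff[OF \<alpha>])
    have "N f $ 2 = conj_Linf \<alpha> \<cdot> (\<phi> \<cdot> f) + \<phi> \<cdot> f"
      by (simp add: N_def second)
    then show ?thesis
      using P_sum[OF f] by (simp add: ker_W N'N[OF that])
  qed
  have N'_in: "N' u \<in> ?V" if "u \<in> ?W" for u
  proof -
    have "\<phi> \<cdot> N' u \<in> H2" "conj_Linf \<alpha> \<cdot> (\<phi> \<cdot> N' u) \<in> H2_minus"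
      using that P_plus_in_H2[of "u $ 2"] P_minus_in_H2_minus[of "u $ 2"] by (simp_all add: ker_W)
    moreover have "N' u \<in> K_perp \<theta>"
      unfolding N'_def S_def by (rule K_perp_sum[OF P_minus_in_H2_minus P_plus_in_H2])
    ultimately show ?thesis by (simp add: ker_D_iff[OF \<alpha>])
  qed
  have NN': "N (N' u) = u" if "u \<in> ?W" for u
  proof -
    have "U (N' u) = u $ 1"
      unfolding U_def N'_def S_def
      by (simp only: decomposition_parts[OF \<theta> P_minus_in_H2_minus P_plus_in_H2] P_plus_P_minus)
    moreover have "(\<phi> * (1 + conj_Linf \<alpha>)) \<cdot> N' u = u $ 2"
      using that P_plus_P_minus(2)[of "u $ 2"] by (simp add: second ker_W)
    ultimately show ?thesis by (simp add: N_def vec_eq_iff forall_2)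
  qed
  have U_lin: "bounded_linear U"
    unfolding U_def
    by (intro bounded_linear_add P_minus_bounded_linear bounded_linear_compose[OF mult_op_bounded_linear] P_plus_bounded_linear)
  have S_lin: "bounded_linear S"
    unfolding S_def
    by (intro bounded_linear_add P_minus_bounded_linear bounded_linear_compose[OF mult_op_bounded_linear] P_plus_bounded_linear)
  have "homeomorphism ?V ?W N N'"
  proof (rule homeomorphismI)
    have "N = (\<lambda>f. \<chi> i. if i = 1 then U f else (\<phi> * (1 + conj_Linf \<alpha>)) \<cdot> f)"
      by (simp add: N_def fun_eq_iff vec_eq_iff forall_2)
    moreover have "continuous_on ?V (\<lambda>f. if i = 1 then U f else (\<phi> * (1 + conj_Linf \<alpha>)) \<cdot> f)" for i :: 2
      using bounded_linear.continuous_on[OF U_lin continuous_on_id] bounded_linear.continuous_on[OF mult_op_bounded_linear continuous_on_id]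
      by (cases "i = 1") auto
    ultimately show "continuous_on ?V N" by (simp add: continuous_on_vec_lambda)
    show "continuous_on ?W N'"
      unfolding N'_def by (intro bounded_linear.continuous_on[OF S_lin] continuous_intros)
  qed (use N_in N'_in N'N NN' in auto)
  moreover have "N (f + g) = N f + N g" for f g
    using linear_add[OF bounded_linear.linear[OF U_lin]] by (simp add: N_def vec_eq_iff forall_2 mult_op_add)
  moreover have "N (const_Linf c \<cdot> f) = (\<chi> i. const_Linf c \<cdot> (N f $ i))" for c f
  proof -
    have comm: "\<psi> \<cdot> (const_Linf c \<cdot> g) = const_Linf c \<cdot> (\<psi> \<cdot> g)" for \<psi> g
      by (simp add: mult.commute flip: mult_op_mult)
    have "U (const_Linf c \<cdot> f) = const_Linf c \<cdot> U f"
      by (simp add: U_def P_minus_def P_plus_const_mult comm mult_op_add mult_op_diff)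
    then show ?thesis by (simp add: N_def vec_eq_iff forall_2 comm)
  qed
  ultimately have iso: "isomorphism_on ?V ?W N" unfolding isomorphism_on_def by blast
  have N_eq: "N (fm + \<theta> \<cdot> fp) = vector [fm + fp, (\<phi> * (1 + conj_Linf \<alpha>)) \<cdot> (fm + \<theta> \<cdot> fp)]"
    if "fm \<in> H2_minus" "fp \<in> H2" for fm fp
    by (simp add: N_def U_def decomposition_parts[OF \<theta> that])
  have unique: "\<exists>!(fm, fp). fm \<in> H2_minus \<and> fp \<in> H2 \<and> f = fm + \<theta> \<cdot> fp" if "f \<in> ?V" for f
  proof (rule ex1I[of _ "(P_minus f, conj_Linf \<theta> \<cdot> P_plus f)"])
    show "case (P_minus f, conj_Linf \<theta> \<cdot> P_plus f) of (fm, fp) \<Rightarrow> fm \<in> H2_minus \<and> fp \<in> H2 \<and> f = fm + \<theta> \<cdot> fp"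
      using V_decomp[OF that] P_minus_in_H2_minus by simp
    show "x = (P_minus f, conj_Linf \<theta> \<cdot> P_plus f)"
      if "case x of (fm, fp) \<Rightarrow> fm \<in> H2_minus \<and> fp \<in> H2 \<and> f = fm + \<theta> \<cdot> fp" for x
      using that decomposition_parts[OF \<theta>, of "fst x" "snd x"] by (cases x) auto
  qed
  have "?V = N' ` ?W"
    using N_in N'_in N'N by force
  then have "?V = (\<lambda>x. P_minus x + \<theta> \<cdot> P_plus x) ` (\<lambda>u. u $ 1) ` ?W"
    by (simp only: N'_def S_def image_image)
  with unique N_eq iso show ?thesis by blast
qed

end
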